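(* Let $\mathfrak{F}$ be a minimal Cauchy filter on $\mathbb{P}^1_K$ that is not convergent, i.e. $\mathfrak{F}\in\mathsf{P}^1_K\setminus\mathbb{P}^1_K$. Then the collection $\mathfrak{D}$ of all balls of $K$ that are elements of $\mathfrak{F}$ is non-empty and totally ordered by inclusion. Moreover, for the intersection $B_{\mathfrak{F}}=\bigcap_{B\in\mathfrak{D}}B$ there are three cases (one of which always holds): 1. $B_{\mathfrak{F}}$ is a closed ball of $K$. Then the collection of all open affinoids of the form $$\{z\in K : r<\min\{|z-a_j| : j=1,\dots,k\}<r'\},$$ where $k$ is a positive integer, $a_1,\dots,a_k\in B_{\mathfrak{F}}$, $r\in(0,\operatorname{diam}(B_{\mathfrak{F}}))$ and $r'>\operatorname{diam}(B_{\mathfrak{F}})$, is a base of the filter $\mathfrak{F}$. 2. $B_{\mathfrak{F}}$ is an irrational ball of $K$. Then the collection of all annuli of the form $\{z\in K: r<|z-a|<r'\}$, with $a\in B_{\mathfrak{F}}$, $r\in(0,\operatorname{diam}(B_{\mathfrak{F}}))$ and $r'>\operatorname{diam}(B_{\mathfrak{F}})$, is a base of the filter $\mathfrak{F}$. 3. $B_{\mathfrak{F}}$ is empty. Then every decreasing sequence of elements of $\mathfrak{D}$ whose intersection is empty is a base of the filter $\mathfrak{F}$. Conversely, every collection as in part 1 (resp. part 2), constructed from a closed (resp. irrational) ball $B$ of $K$ in place of $B_{\mathfrak{F}}$, and every decreasing sequence of balls of $K$ whose intersection is empty, is a base of a minimal Cauchy filter that is not convergent.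
   Context: Standing assumptions: $K$ is a field complete for an ultrametric absolute value $|\cdot|$, with infinite residue field and with value group $|K^*|=\{|z|:z\in K\setminus\{0\}\}$ not discrete. $\mathbb{P}^1_K=K\sqcup\{\infty\}$ has the topology of the chordal distance $\Delta([x:y],[x':y'])=\frac{|xy'-yx'|}{\max\{|x|,|y|\}\max\{|x'|,|y'|\}}$; convergence of filters is with respect to this topology. For $B\subset K$, $\operatorname{diam}(B)=\sup_{z,z'\in B}|z-z'|$. For $a\in K$ and $r\in|K^*|$, $\{|z-a|<r\}$ is an open ball of $K$ and $\{|z-a|\le r\}$ a closed ball of $K$; for $r>0$ with $r\notin|K^*|$ these two sets coincide and form an irrational ball of $K$. A ball of $K$ is any of these. An open (resp. closed, irrational) ball of $\mathbb{P}^1_K$ is an open (resp. closed, irrational) ball of $K$ or the complement in $\mathbb{P}^1_K$ of a closed (resp. open, irrational) ball of $K$. An open affinoid is a finite intersection of open balls of $\mathbb{P}^1_K$ ($\mathbb{P}^1_K$ itself being the empty intersection). $\mathbb{P}^1_K$ carries the uniform structure whose entourages are the sets containing $V(C)=\bigcup_{Y\in C}Y\times Y$ for some finite cover $C$ of $\mathbb{P}^1_K$ by open affinoids. A filter on $\mathbb{P}^1_K$ is Cauchy if for every entourage $V$ it contains a set $Y$ with $Y\times Y\subset V$. A Cauchy filter is minimal if it is minimal for inclusion among Cauchy filters. $\mathsf{P}^1_K$ is the set of all minimal Cauchy filters, and $\mathbb{P}^1_K$ is identified with its subset of convergent ones (a point corresponds to its neighbourhood filter). A base of a filter $\mathfrak{F}$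 is a collection $\mathfrak{B}$ of subsets such that $\mathfrak{F}$ consists exactly of the sets containing an element of $\mathfrak{B}$. *)

theory Defs
  imports "HOL-Analysis.Analysis"
begin

locale ultrametric_abs =
  fixes av :: "'k::field \<Rightarrow> real"
  assumes av_nonneg: "0 \<le> av x"
    and av_eq_0_iff: "av x = 0 \<longleftrightarrow> x = 0"
    and av_mult: "av (x * y) = av x * av y"
    and av_ultra: "av (x + y) \<le> max (av x) (av y)"
begin

lemma av_one [simp]: "av 1 = 1"
  using av_mult[of 1 1] av_eq_0_iff[of 1] by simp

lemma av_minus [simp]: "av (- x) = av x"
proof -
  have "av (-1) * av (-1) = 1"
    using av_mult[of "-1" "-1"] by simp
  then have "(av (-1))\<^sup>2 = 1"
    by (simp add: power2_eq_square)
  then have "av (-1) = 1"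
    using av_nonneg[of "-1"] by (auto simp: power2_eq_1_iff)
  then show ?thesis
    using av_mult[of "-1" x] by simp
qed

lemma Metric_space_av: "Metric_space UNIV (\<lambda>x y. av (x - y))"
proof
  fix x y z :: 'k
  show "0 \<le> av (x - y)" by (rule av_nonneg)
  show "av (x - y) = av (y - x)" using av_minus[of "x - y"] by simp
  show "av (x - y) = 0 \<longleftrightarrow> x = y" by (simp add: av_eq_0_iff)
  show "av (x - z) \<le> av (x - y) + av (y - z)"
    using av_ultra[of "x - y" "y - z"] av_nonneg[of "x - y"] av_nonneg[of "y - z"] by simp
qed

end

definition value_group :: "('k::field \<Rightarrow> real) \<Rightarrow> real set" where
  "value_group av = av ` (UNIV - {0})"

text \<open>The residue field as a set: the valuation ring modulo its maximal ideal.\<close>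

definition residue_field :: "('k::field \<Rightarrow> real) \<Rightarrow> 'k set set" where
  "residue_field av =
     {x. av x \<le> 1} // {(x, y). av x \<le> 1 \<and> av y \<le> 1 \<and> av (x - y) < 1}"

locale ultrametric_field = ultrametric_abs av for av :: "'k::field \<Rightarrow> real" +
  assumes complete: "Metric_space.mcomplete UNIV (\<lambda>x y. av (x - y))"
    and infinite_residue_field: "infinite (residue_field av)"
    and not_discrete: "\<not> discrete (value_group av)"

datatype 'k proj_line = Pt 'k | Infty

fun hom_coords :: "'k::field proj_line \<Rightarrow> 'k \<times> 'k" where
  "hom_coords (Pt z) = (z, 1)"
| "hom_coords Infty = (1, 0)"

definition chordal :: "('k::field \<Rightarrow> real) \<Rightarrow> 'k proj_line \<Rightarrow> 'k proj_line \<Rightarrow> real" where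
  "chordal av P Q =
     (case hom_coords P of (x, y) \<Rightarrow> case hom_coords Q of (x', y') \<Rightarrow>
        av (x * y' - y * x') / (max (av x) (av y) * max (av x') (av y')))"

lemma (in ultrametric_abs) Metric_space_chordal: "Metric_space UNIV (chordal av)"
proof
  fix P Q R :: "'k proj_line"
  obtain x y where P: "hom_coords P = (x, y)" by fastforce
  obtain x' y' where Q: "hom_coords Q = (x', y')" by fastforce
  obtain x'' y'' where R: "hom_coords R = (x'', y'')" by fastforce
  have pos: "0 < max (av a) (av b)" if "hom_coords S = (a, b)" for S a b
    using that by (cases S) (auto simp: less_max_iff_disj)
  define p where "p = max (av x) (av y)"
  define q where "q = max (av x') (av y')"
  define r where "r = max (av x'') (av y'')"
  have pqr: "p > 0" "q > 0" "r > 0"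
    using pos[OF P] pos[OF Q] pos[OF R] by (simp_all add: p_def q_def r_def)
  have PQ: "chordal av P Q = av (x * y' - y * x') / (p * q)"
    and QR: "chordal av Q R = av (x' * y'' - y' * x'') / (q * r)"
    and PR: "chordal av P R = av (x * y'' - y * x'') / (p * r)"
    by (simp_all add: chordal_def P Q R p_def q_def r_def)
  have QP: "chordal av Q P = av (x' * y - y' * x) / (q * p)"
    by (simp add: chordal_def P Q p_def q_def)
  show nonneg: "0 \<le> chordal av P Q"
    using pqr by (simp add: PQ av_nonneg)
  show "chordal av P Q = chordal av Q P"
    using av_minus[of "x * y' - y * x'"] by (simp add: PQ QP mult.commute)
  have "x * y' - y * x' = 0 \<longleftrightarrow> P = Q"
    using P Q by (cases P; cases Q) auto
  then show "chordal av P Q = 0 \<longleftrightarrow> P = Q"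
    using pqr by (simp add: PQ av_eq_0_iff)
  let ?m = "max (r * av (x * y' - y * x')) (p * av (x' * y'' - y' * x''))"
  have bound: "av (c * a + d * b) \<le> max (r * av a) (p * av b)"
    if "av c \<le> r" "av d \<le> p" for a b c d
    using av_ultra[of "c * a" "d * b"] that
      mult_right_mono[OF that(1) av_nonneg[of a]] mult_right_mono[OF that(2) av_nonneg[of b]]
    by (simp add: av_mult max_def split: if_splits)
  have "av y' * av (x * y'' - y * x'') \<le> ?m"
    using bound[of y'' y "x * y' - y * x'" "x' * y'' - y' * x''"]
    by (simp add: av_mult[symmetric] r_def p_def algebra_simps)
  moreover have "av x' * av (x * y'' - y * x'') \<le> ?m"
    using bound[of x'' x "x * y' - y * x'" "x' * y'' - y' * x''"]
    by (simp add: av_mult[symmetric] r_def p_def algebra_simps)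
  ultimately have "q * av (x * y'' - y * x'') \<le> ?m"
    by (simp add: q_def max_def split: if_splits)
  also have "?m \<le> r * av (x * y' - y * x') + p * av (x' * y'' - y' * x'')"
    using pqr by (simp add: av_nonneg)
  finally show "chordal av P R \<le> chordal av P Q + chordal av Q R"
    using pqr unfolding PQ QR PR by (simp add: divide_simps) (simp add: algebra_simps)
qed

abbreviation proj_topology :: "('k::field \<Rightarrow> real) \<Rightarrow> 'k proj_line topology" where
  "proj_topology av \<equiv> Metric_space.mtopology UNIV (chordal av)"

definition open_ball :: "('k::field \<Rightarrow> real) \<Rightarrow> 'k set \<Rightarrow> bool" where
  "open_ball av B \<longleftrightarrow> (\<exists>a. \<exists>r\<in>value_group av. B = {z. av (z - a) < r})"

definition closed_ball :: "('k::field \<Rightarrow> real) \<Rightarrow> 'k set \<Rightarrow> bool" where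
  "closed_ball av B \<longleftrightarrow> (\<exists>a. \<exists>r\<in>value_group av. B = {z. av (z - a) \<le> r})"

definition irrational_ball :: "('k::field \<Rightarrow> real) \<Rightarrow> 'k set \<Rightarrow> bool" where
  "irrational_ball av B \<longleftrightarrow>
     (\<exists>a. \<exists>r. 0 < r \<and> r \<notin> value_group av \<and> B = {z. av (z - a) \<le> r})"

definition is_ball :: "('k::field \<Rightarrow> real) \<Rightarrow> 'k set \<Rightarrow> bool" where
  "is_ball av B \<longleftrightarrow> open_ball av B \<or> closed_ball av B \<or> irrational_ball av B"

definition diam :: "('k::field \<Rightarrow> real) \<Rightarrow> 'k set \<Rightarrow> real" where
  "diam av B = Sup {av (z - z') | z z'. z \<in> B \<and> z' \<in> B}"

definition proj_open_ball :: "('k::field \<Rightarrow> real) \<Rightarrow> 'k proj_line set \<Rightarrow> bool" where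
  "proj_open_ball av U \<longleftrightarrow>
     (\<exists>B. open_ball av B \<and> U = Pt ` B) \<or> (\<exists>B. closed_ball av B \<and> U = - (Pt ` B))"

definition open_affinoid :: "('k::field \<Rightarrow> real) \<Rightarrow> 'k proj_line set \<Rightarrow> bool" where
  "open_affinoid av Y \<longleftrightarrow>
     (\<exists>\<U>. finite \<U> \<and> (\<forall>U\<in>\<U>. proj_open_ball av U) \<and> Y = \<Inter>\<U>)"

definition entourage :: "('k::field \<Rightarrow> real) \<Rightarrow> ('k proj_line \<times> 'k proj_line) set \<Rightarrow> bool" where
  "entourage av V \<longleftrightarrow>
     (\<exists>C. finite C \<and> (\<forall>Y\<in>C. open_affinoid av Y) \<and> \<Union>C = UNIV \<and> (\<Union>Y\<in>C. Y \<times> Y) \<subseteq> V)"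

definition filter_sets :: "'a filter \<Rightarrow> 'a set set" where
  "filter_sets F = {S. eventually (\<lambda>x. x \<in> S) F}"

text \<open>Filters in the usual sense are proper, whereas the type \<^typ>\<open>'a filter\<close>
  also contains \<^term>\<open>bot\<close>; properness is therefore part of the Cauchy condition.\<close>

definition cauchy :: "('k::field \<Rightarrow> real) \<Rightarrow> 'k proj_line filter \<Rightarrow> bool" where
  "cauchy av F \<longleftrightarrow>
     F \<noteq> bot \<and> (\<forall>V. entourage av V \<longrightarrow> (\<exists>Y\<in>filter_sets F. Y \<times> Y \<subseteq> V))"

text \<open>Minimality refers to inclusion of filters as collections of sets, which is the
  reverse of the order \<^term>\<open>(\<le>)\<close> on \<^typ>\<open>'a filter\<close>.\<close>

definition minimal_cauchy :: "('k::field \<Rightarrow> real) \<Rightarrow> 'k proj_line filter \<Rightarrow> bool" where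
  "minimal_cauchy av F \<longleftrightarrow>
     cauchy av F \<and> (\<forall>G. cauchy av G \<and> filter_sets G \<subseteq> filter_sets F \<longrightarrow> G = F)"

definition proj_convergent :: "('k::field \<Rightarrow> real) \<Rightarrow> 'k proj_line filter \<Rightarrow> bool" where
  "proj_convergent av F \<longleftrightarrow> (\<exists>P. F \<le> nhdsin (proj_topology av) P)"

definition filter_base :: "'a set set \<Rightarrow> 'a filter \<Rightarrow> bool" where
  "filter_base \<B> F \<longleftrightarrow> filter_sets F = {S. \<exists>B\<in>\<B>. B \<subseteq> S}"

definition balls_in :: "('k::field \<Rightarrow> real) \<Rightarrow> 'k proj_line filter \<Rightarrow> 'k set set" where
  "balls_in av F = {B. is_ball av B \<and> Pt ` B \<in> filter_sets F}"

text \<open>The requirement of being an open affinoid constrains the real numbers \<open>r\<close> and \<open>r'\<close>: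
  if they lie outside the value group, the displayed set need not be an open affinoid.\<close>

definition affinoid_collection :: "('k::field \<Rightarrow> real) \<Rightarrow> 'k set \<Rightarrow> 'k proj_line set set" where
  "affinoid_collection av B =
     {Y. open_affinoid av Y \<and>
         (\<exists>(k::nat) a r r'. 0 < k \<and> (\<forall>j\<in>{1..k}. a j \<in> B) \<and>
            0 < r \<and> r < diam av B \<and> diam av B < r' \<and>
            Y = Pt ` {z. r < Min ((\<lambda>j. av (z - a j)) ` {1..k}) \<and>
                         Min ((\<lambda>j. av (z - a j)) ` {1..k}) < r'})}"

definition annulus_collection :: "('k::field \<Rightarrow> real) \<Rightarrow> 'k set \<Rightarrow> 'k proj_line set set" where
  "annulus_collection av B =
     {Pt ` {z. r < av (z - a) \<and> av (z - a) < r'} | a r r'.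
        a \<in> B \<and> 0 < r \<and> r < diam av B \<and> diam av B < r'}"

end

theory Submission
  imports Defs
begin

text \<open>
  A closed disc of radius \<open>\<rho> > 0\<close> around \<open>a\<close> (rational or irrational) defines a filter
  \<open>disc_filter a \<rho>\<close>: it is generated by the open discs around \<open>a\<close> of radius greater than \<open>\<rho>\<close> and the
  complements of the closed discs of radius less than \<open>\<rho>\<close> around the points of the disc. A decreasing
  sequence of balls with empty intersection generates a filter as well. The theorem follows from
  four facts.

  Both kinds of filters are Cauchy. They decide almost every open ball: the ball or its complement
  belongs to the filter. The exceptions are the branches at a disc of rational radius, and as the
  residue field is infinite, finitely many of these never form a set of the filter. By \<open>cauchyI\<close> this
  is enough to find, in every finite cover by open affinoids, a member that belongs to the filter.

  Both kinds of filters are minimal, and they do not converge. Every Cauchy filter contains, for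
  \<open>s < s'\<close>, either the open disc of radius \<open>s'\<close> or the complement of the closed disc of radius
  \<open>s\<close> around a given point (\<open>cauchy_dichotomy\<close>). In a Cauchy filter that is contained in one of the
  given filters, this forces every generator to be present.

  A minimal Cauchy filter \<open>F\<close> that does not converge contains a ball, or else it would converge to
  infinity. If \<open>a\<close> lies in all balls in \<open>F\<close>, let \<open>\<rho>\<close> be the infimum of the radii of the discs around \<open>a\<close>
  in \<open>F\<close>. The dichotomy shows that \<open>F\<close> contains \<open>disc_filter a \<rho>\<close>, which is Cauchy, so both are equal
  (\<open>minimal_cauchy_eq_disc_filter\<close>). Likewise \<open>F\<close> equals the filter of every decreasing sequence of
  balls in \<open>F\<close> with empty intersection.

  Finally, the balls in \<open>disc_filter a \<rho>\<close> intersect in exactly the closed disc of radius \<open>\<rho>\<close>, and the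
  affinoids (for irrational \<open>\<rho>\<close>, the annuli) of the theorem form a base of this filter. The value group
  is dense in the positive reals, so radii can always be adjusted to be values.
\<close>


section \<open>Ultrametric geometry of the field\<close>

context ultrametric_abs
begin

abbreviation odisc :: "'k \<Rightarrow> real \<Rightarrow> 'k set" where
  "odisc a r \<equiv> {z. av (z - a) < r}"

abbreviation cdisc :: "'k \<Rightarrow> real \<Rightarrow> 'k set" where
  "cdisc a r \<equiv> {z. av (z - a) \<le> r}"

lemma av_zero [simp]: "av 0 = 0"
  by (simp add: av_eq_0_iff)

lemma dist_sym: "av (x - y) = av (y - x)"
  using av_minus[of "x - y"] by simp

lemma dist_ultra: "av (x - z) \<le> max (av (x - y)) (av (y - z))"
  using av_ultra[of "x - y" "y - z"] by simp

lemma dist_le: "av (x - y) \<le> r \<Longrightarrow> av (y - z) \<le> r \<Longrightarrow> av (x - z) \<le> r"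
  using dist_ultra[of x z y] by linarith

lemma dist_less: "av (x - y) < r \<Longrightarrow> av (y - z) < r \<Longrightarrow> av (x - z) < r"
  using dist_ultra[of x z y] by linarith

lemma dist_isosceles:
  assumes "av (y - z) < av (x - y)"
  shows "av (x - z) = av (x - y)"
  using dist_ultra[of x z y] dist_ultra[of x y z] dist_sym[of y z] assms by linarith

lemma av_inverse: "av (inverse x) = inverse (av x)"
proof (cases "x = 0")
  case False
  then have "av x * av (inverse x) = 1"
    using av_mult[of x "inverse x"] by simp
  then show ?thesis
    by (metis inverse_unique)
qed simp

lemma av_divide: "av (x / y) = av x / av y"
  by (simp add: divide_inverse av_mult av_inverse)

lemma av_power: "av (x ^ n) = av x ^ n"
  by (induction n) (auto simp: av_mult)

lemma av_power_int: "av (x powi n) = av x powi n"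
  by (simp add: power_int_def av_power av_inverse)

lemma av_pos_iff: "0 < av x \<longleftrightarrow> x \<noteq> 0"
  using av_nonneg[of x] av_eq_0_iff[of x] by linarith

lemma value_group_iff: "r \<in> value_group av \<longleftrightarrow> (\<exists>x. av x = r) \<and> 0 < r"
  by (auto simp: value_group_def image_iff av_pos_iff)

lemma av_in_value_group: "0 < av x \<Longrightarrow> av x \<in> value_group av"
  by (auto simp: value_group_iff)

text \<open>Balls of all three kinds have this property, which mentions neither centre nor radius and already
  implies that intersecting balls are nested. Most arguments about balls below use only this.\<close>

definition dist_convex :: "'k set \<Rightarrow> bool" where
  "dist_convex S \<longleftrightarrow> (\<forall>x\<in>S. \<forall>y\<in>S. cdisc x (av (y - x)) \<subseteq> S)"

lemma dist_convexD:
  "dist_convex S \<Longrightarrow> x \<in> S \<Longrightarrow> y \<in> S \<Longrightarrow> av (z - x) \<le> av (y - x) \<Longrightarrow> z \<in> S"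
  by (auto simp: dist_convex_def)

lemma dist_convex_odisc: "dist_convex (odisc a r)"
  unfolding dist_convex_def
proof clarify
  fix x y z assume *: "av (x - a) < r" "av (y - a) < r" "av (z - x) \<le> av (y - x)"
  have "av (y - x) < r"
    using dist_less[of y a r x] * by (simp add: dist_sym)
  with * show "av (z - a) < r"
    using dist_less[of z x r a] by simp
qed

lemma dist_convex_cdisc: "dist_convex (cdisc a r)"
  unfolding dist_convex_def
proof clarify
  fix x y z assume *: "av (x - a) \<le> r" "av (y - a) \<le> r" "av (z - x) \<le> av (y - x)"
  have "av (y - x) \<le> r"
    using dist_le[of y a r x] * by (simp add: dist_sym)
  with * show "av (z - a) \<le> r"
    using dist_le[of z x r a] by simp
qed

lemma is_ball_cases:
  assumes "is_ball av S"
  obtains a r where "0 < r" "S = odisc a r" | a r where "0 < r" "S = cdisc a r"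
proof -
  have "\<exists>a r. 0 < r \<and> (S = odisc a r \<or> S = cdisc a r)"
    using assms unfolding is_ball_def open_ball_def closed_ball_def irrational_ball_def
    by (metis value_group_iff)
  then show ?thesis using that by blast
qed

lemma is_ball_imp_dist_convex: "is_ball av S \<Longrightarrow> dist_convex S"
  by (elim is_ball_cases) (simp_all add: dist_convex_odisc dist_convex_cdisc)

lemma is_ball_bounded: "is_ball av S \<Longrightarrow> \<exists>r>0. S \<subseteq> odisc a r"
proof (elim is_ball_cases)
  have *: "cdisc b r \<subseteq> odisc a (max r (av (b - a)) + 1)" for b r
  proof clarify
    fix z assume "av (z - b) \<le> r"
    then show "av (z - a) < max r (av (b - a)) + 1"
      using dist_ultra[of z a b] by linarith
  qed
  fix b and r :: real assume "0 < r"
  then have "0 < max r (av (b - a)) + 1" by simp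
  moreover have "odisc b r \<subseteq> cdisc b r" by auto
  ultimately show "S = odisc b r \<Longrightarrow> ?thesis" "S = cdisc b r \<Longrightarrow> ?thesis"
    using * by blast+
qed

lemma is_ball_nonempty: "is_ball av S \<Longrightarrow> S \<noteq> {}"
proof (elim is_ball_cases)
  fix a and r :: real assume "0 < r"
  then have "a \<in> odisc a r" "a \<in> cdisc a r" by simp_all
  then show "S = odisc a r \<Longrightarrow> ?thesis" "S = cdisc a r \<Longrightarrow> ?thesis" by blast+
qed

lemma dist_convex_nested:
  assumes "dist_convex S" "dist_convex T" "S \<inter> T \<noteq> {}"
  shows "S \<subseteq> T \<or> T \<subseteq> S"
proof (rule ccontr)
  assume "\<not> (S \<subseteq> T \<or> T \<subseteq> S)"
  then obtain x y z where "x \<in> S" "x \<in> T" "y \<in> S" "y \<notin> T" "z \<in> T" "z \<notin> S"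
    using assms by blast
  then show False
    using dist_convexD[OF assms(1), of x y z] dist_convexD[OF assms(2), of x z y] by linarith
qed

lemma odisc_recenter: "b \<in> odisc a r \<Longrightarrow> odisc a r = odisc b r"
proof (intro equalityI subsetI)
  fix z assume b: "b \<in> odisc a r"
  show "z \<in> odisc b r" if "z \<in> odisc a r" using dist_less[of z a r b] that b dist_sym[of a b] by simp
  show "z \<in> odisc a r" if "z \<in> odisc b r" using dist_less[of z b r a] that b by simp
qed

lemma cdisc_recenter: "b \<in> cdisc a r \<Longrightarrow> cdisc a r = cdisc b r"
proof (intro equalityI subsetI)
  fix z assume b: "b \<in> cdisc a r"
  show "z \<in> cdisc b r" if "z \<in> cdisc a r" using dist_le[of z a r b] that b dist_sym[of a b] by simp
  show "z \<in> cdisc a r" if "z \<in> cdisc b r" using dist_le[of z b r a] that b by simp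
qed

end

context ultrametric_field
begin

text \<open>A subgroup of the positive reals in which some point is not isolated contains elements
  arbitrarily close to \<open>1\<close>. The powers of an element \<open>u\<close> with \<open>1 < av u < y / x\<close> make steps too
  small to jump over the interval from \<open>x\<close> to \<open>y\<close>.\<close>

lemma value_group_dense:
  assumes "0 < x" "x < y"
  obtains v where "x < av v" "av v < y"
proof -
  obtain u where u: "1 < av u" "av u < y / x"
  proof -
    obtain s where s: "s \<in> value_group av" "\<not> s isolated_in value_group av"
      using not_discrete discreteI by blast
    define c where "c = y / x"
    have c: "1 < c" using assms by (simp add: c_def)
    have s0: "0 < s" using s by (simp add: value_group_iff)
    define e where "e = min (s * (c - 1)) (s - s / c)"
    have "s / c < s" using c s0 by (simp add: divide_simps)
    then have "0 < e" using c s0 by (simp add: e_def)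
    then obtain t where t: "t \<in> value_group av" "dist s t < e" "t \<noteq> s"
      using s by (auto simp: isolated_in_dist_Ex_iff)
    then have t0: "0 < t" by (simp add: value_group_iff)
    obtain p q where p: "av p = s" and q: "av q = t" using s t by (auto simp: value_group_iff)
    have "t < s * c" "s / c < t"
      using t(2) by (auto simp: e_def dist_real_def algebra_simps)
    then have *: "t / s < c" "s / t < c"
      using s0 t0 c by (auto simp: divide_simps mult.commute)
    show ?thesis
    proof (cases "s < t")
      case True
      then show ?thesis using that[of "q / p"] * s0 by (simp add: av_divide p q c_def)
    next
      case False
      then show ?thesis using that[of "p / q"] * t0 t(3) by (simp add: av_divide p q c_def)
    qed
  qed
  define n where "n = \<lfloor>log (av u) x\<rfloor>"
  have pw: "av (u powi k) = av u powr k" for k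
    using u by (simp add: av_power_int powr_real_of_int')
  have "x = av u powr (log (av u) x)" using u assms by simp
  also have "\<dots> < av (u powi (n + 1))"
    unfolding pw using u by (intro powr_less_mono) (auto simp: n_def)
  finally have 1: "x < av (u powi (n + 1))" .
  \<comment> \<open>The preceding power is at most x, and the last step multiplies by less than y / x.\<close>
  have "av (u powi (n + 1)) = av u * av u powr n"
    unfolding pw using u by (simp add: powr_add)
  also have "av u powr n \<le> av u powr (log (av u) x)"
    using u by (intro powr_mono) (auto simp: n_def)
  also have "\<dots> = x" using u assms by simp
  also have "av u * x < y" using u assms by (simp add: divide_simps)
  finally have "av (u powi (n + 1)) < y" using u by simp
  with 1 that show ?thesis by blast
qed

lemma value_group_dense_set:
  assumes "0 < x" "x < y"
  obtains r where "x < r" "r < y" "r \<in> value_group av"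
proof -
  obtain v where "x < av v" "av v < y" using value_group_dense[OF assms] .
  then show thesis using that[of "av v"] av_in_value_group[of v] assms(1) by simp
qed

text \<open>Density of the value group is what makes this true also when \<open>r\<close> is not a value. As a
  consequence a closed or irrational ball determines its radius.\<close>

lemma diam_cdisc:
  assumes "0 < r"
  shows "diam av (cdisc a r) = r"
proof -
  let ?D = "{av (z - z') | z z'. z \<in> cdisc a r \<and> z' \<in> cdisc a r}"
  have up: "x \<le> r" if "x \<in> ?D" for x
    using that dist_le[of _ a r] by (auto simp: dist_sym)
  have "Sup ?D = r"
  proof (rule cSup_eq)
    show "r \<le> y" if y: "\<And>x. x \<in> ?D \<Longrightarrow> x \<le> y" for y
    proof (rule ccontr)
      assume "\<not> r \<le> y"
      then have "max y (r / 2) < r" "0 < max y (r / 2)" using assms by auto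
      then obtain v where v: "max y (r / 2) < av v" "av v < r"
        using value_group_dense by blast
      have "av ((a + v) - a) \<in> ?D"
        using v assms by (intro CollectI exI[of _ "a + v"] exI[of _ a] conjI)
          auto
      then show False using y[of "av v"] v by simp
    qed
  qed (rule up)
  then show ?thesis by (simp add: diam_def)
qed

text \<open>After rescaling to the valuation ring, a finite set \<open>A\<close> that came within distance less than \<open>r\<close> of
  every point of the disc would represent all residue classes, but there are infinitely many.\<close>

lemma cdisc_avoid_finite:
  assumes r: "r \<in> value_group av" and A: "finite A"
  obtains z where "z \<in> cdisc a r" "\<And>b. b \<in> A \<Longrightarrow> r \<le> av (z - b)"
proof -
  obtain w where w: "av w = r" "0 < r" using r by (auto simp: value_group_iff)
  then have w0: "w \<noteq> 0" by auto
  define A' where "A' = (\<lambda>b. (b - a) / w) ` A"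
  have "\<exists>x. av x \<le> 1 \<and> (\<forall>b\<in>A'. 1 \<le> av (x - b))"
  proof (rule ccontr)
    assume "\<not> ?thesis"
    then have near: "\<exists>b\<in>A'. av (x - b) < 1" if "av x \<le> 1" for x
      using that by force
    have "residue_field av \<subseteq> (\<lambda>b. {y. av y \<le> 1 \<and> av (y - b) < 1}) ` A'"
    proof
      fix X assume "X \<in> residue_field av"
      then obtain x where x: "av x \<le> 1" "X = {y. av y \<le> 1 \<and> av (x - y) < 1}"
        by (auto simp: residue_field_def quotient_def)
      obtain b where b: "b \<in> A'" "av (x - b) < 1" using near[OF x(1)] by blast
      have "X = {y. av y \<le> 1 \<and> av (y - b) < 1}"
        using odisc_recenter[of x b 1] b(2) dist_sym[of x] by (auto simp: x(2))
      with b show "X \<in> (\<lambda>b. {y. av y \<le> 1 \<and> av (y - b) < 1}) ` A'" by blast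
    qed
    moreover have "finite A'" using A by (simp add: A'_def)
    ultimately show False using infinite_residue_field finite_surj by blast
  qed
  then obtain x where x: "av x \<le> 1" "\<And>b. b \<in> A' \<Longrightarrow> 1 \<le> av (x - b)" by blast
  show ?thesis
  proof
    show "a + w * x \<in> cdisc a r" using x(1) w by (simp add: av_mult)
    fix b assume b: "b \<in> A"
    have "a + w * x - b = w * (x - (b - a) / w)" using w0 by (simp add: field_simps)
    then show "r \<le> av (a + w * x - b)"
      using x(2)[of "(b - a) / w"] b w(2) by (auto simp: A'_def av_mult w(1))
  qed
qed

end

section \<open>Filters and uniformity\<close>

lemma filter_sets_iff: "S \<in> filter_sets F \<longleftrightarrow> eventually (\<lambda>x. x \<in> S) F"
  by (simp add: filter_sets_def)

lemma filter_sets_upward: "S \<in> filter_sets F \<Longrightarrow> S \<subseteq> T \<Longrightarrow> T \<in> filter_sets F"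
  by (auto simp: filter_sets_iff elim: eventually_mono)

lemma filter_sets_Int: "S \<in> filter_sets F \<Longrightarrow> T \<in> filter_sets F \<Longrightarrow> S \<inter> T \<in> filter_sets F"
  by (simp add: filter_sets_iff eventually_conj)

lemma filter_sets_INT:
  "finite I \<Longrightarrow> (\<And>i. i \<in> I \<Longrightarrow> f i \<in> filter_sets F) \<Longrightarrow> (\<Inter>i\<in>I. f i) \<in> filter_sets F"
  by (simp add: filter_sets_iff eventually_ball_finite)

lemma filter_sets_meet:
  "F \<noteq> bot \<Longrightarrow> S \<in> filter_sets F \<Longrightarrow> T \<in> filter_sets F \<Longrightarrow> S \<inter> T \<noteq> {}"
proof
  assume "F \<noteq> bot" "S \<in> filter_sets F" "T \<in> filter_sets F" "S \<inter> T = {}"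
  then have "{} \<in> filter_sets F" using filter_sets_Int[of S F T] by simp
  with \<open>F \<noteq> bot\<close> show False by (simp add: filter_sets_iff)
qed

lemma filter_sets_inject: "filter_sets F = filter_sets G \<Longrightarrow> F = G"
proof (rule filter_eqI)
  fix P assume "filter_sets F = filter_sets G"
  then have "Collect P \<in> filter_sets F \<longleftrightarrow> Collect P \<in> filter_sets G" by simp
  then show "eventually P F \<longleftrightarrow> eventually P G" by (simp add: filter_sets_iff)
qed

lemma filter_base_INF_principal:
  assumes "\<B> \<noteq> {}" "\<And>X Y. X \<in> \<B> \<Longrightarrow> Y \<in> \<B> \<Longrightarrow> \<exists>Z\<in>\<B>. Z \<subseteq> X \<inter> Y"
  shows "filter_base \<B> (INF X\<in>\<B>. principal X)"
proof -
  have "eventually P (INF X\<in>\<B>. principal X) \<longleftrightarrow> (\<exists>X\<in>\<B>. eventually P (principal X))" for P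
  proof (rule eventually_INF_base[OF assms(1)])
    fix X Y assume "X \<in> \<B>" "Y \<in> \<B>"
    from assms(2)[OF this]
    show "\<exists>Z\<in>\<B>. principal Z \<le> inf (principal X) (principal Y)" by simp
  qed
  then show ?thesis
    by (simp add: filter_base_def filter_sets_def eventually_principal subset_iff Ball_def)
qed

lemma filter_base_filter_sets_iff:
  "filter_base \<B> F \<Longrightarrow> S \<in> filter_sets F \<longleftrightarrow> (\<exists>B\<in>\<B>. B \<subseteq> S)"
  by (simp add: filter_base_def)

lemma filter_base_imp_filter_sets_subset:
  assumes "filter_base \<B> F" "\<And>B. B \<in> \<B> \<Longrightarrow> B \<in> filter_sets G"
  shows "filter_sets F \<subseteq> filter_sets G"
proof
  fix S assume "S \<in> filter_sets F"
  then obtain B where "B \<in> \<B>" "B \<subseteq> S" using assms(1) by (auto simp: filter_base_def)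
  with assms(2) show "S \<in> filter_sets G" using filter_sets_upward by metis
qed

text \<open>A criterion for being Cauchy that looks at single balls instead of covers. Let \<open>\<T>\<close> collect the
  open balls on which the filter is undecided. If no member of a finite cover by affinoids
  belonged to the filter, every member would lie in a ball \<open>W\<close> that does not belong to it either.
  Intersecting the complements that belong to the filter leaves a set of the filter that is covered
  by finitely many members of \<open>\<T>\<close>, contrary to the second assumption. So a single member of the cover
  lies in the filter. The case \<open>\<T>' = {}\<close> of the second assumption says that the filter is proper.\<close>

lemma cauchyI:
  assumes decide: "\<And>U. proj_open_ball av U \<Longrightarrow>
      U \<in> filter_sets F \<or> - U \<in> filter_sets F \<or> U \<in> \<T>"
    and small: "\<And>\<T>'. finite \<T>' \<Longrightarrow> \<T>' \<subseteq> \<T> \<Longrightarrow> \<Union>\<T>' \<notin> filter_sets F"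
  shows "cauchy av F"
proof -
  have "F \<noteq> bot" using small[of "{}"] by (auto simp: filter_sets_iff)
  moreover have "\<exists>Y\<in>filter_sets F. Y \<times> Y \<subseteq> V" if V: "entourage av V" for V
  proof -
    obtain C where C: "finite C" "\<forall>Y\<in>C. open_affinoid av Y" "\<Union>C = UNIV"
        "(\<Union>Y\<in>C. Y \<times> Y) \<subseteq> V"
      using V unfolding entourage_def by blast
    have "\<exists>Y\<in>C. Y \<in> filter_sets F"
    proof (rule ccontr)
      assume no: "\<not> ?thesis"
      have "\<exists>W. proj_open_ball av W \<and> W \<notin> filter_sets F \<and> Y \<subseteq> W" if Y: "Y \<in> C" for Y
      proof -
        have "open_affinoid av Y" using C(2) Y by blast
        then obtain \<U> where U: "finite \<U>" "\<forall>U\<in>\<U>. proj_open_ball av U" "Y = \<Inter>\<U>"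
          unfolding open_affinoid_def by blast
        then have "\<exists>W\<in>\<U>. W \<notin> filter_sets F"
          using no Y filter_sets_INT[of \<U> "\<lambda>x. x" F] by auto
        with U show ?thesis by blast
      qed
      then obtain W where W: "\<And>Y. Y \<in> C \<Longrightarrow> proj_open_ball av (W Y)"
          "\<And>Y. Y \<in> C \<Longrightarrow> W Y \<notin> filter_sets F" "\<And>Y. Y \<in> C \<Longrightarrow> Y \<subseteq> W Y"
        by metis
      define I where "I = {Y \<in> C. - W Y \<in> filter_sets F}"
      have "(\<Inter>Y\<in>I. - W Y) \<in> filter_sets F"
        using C(1) by (intro filter_sets_INT) (auto simp: I_def)
      moreover have "(\<Inter>Y\<in>I. - W Y) \<subseteq> \<Union>(W ` (C - I))"
      proof
        fix x assume x: "x \<in> (\<Inter>Y\<in>I. - W Y)"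
        have "x \<in> \<Union>C" using C(3) by simp
        then obtain Y where Y: "Y \<in> C" "x \<in> Y" by blast
        then have "x \<in> W Y" using W(3) by blast
        with x have "Y \<notin> I" by auto
        with Y(1) \<open>x \<in> W Y\<close> show "x \<in> \<Union>(W ` (C - I))" by blast
      qed
      ultimately have "\<Union>(W ` (C - I)) \<in> filter_sets F" by (rule filter_sets_upward)
      moreover have "W ` (C - I) \<subseteq> \<T>"
      proof clarify
        fix Y assume "Y \<in> C" "Y \<notin> I"
        then show "W Y \<in> \<T>" using W(1,2)[of Y] decide[of "W Y"] by (auto simp: I_def)
      qed
      ultimately show False using small[of "W ` (C - I)"] C(1) by blast
    qed
    then obtain Y where Y: "Y \<in> C" "Y \<in> filter_sets F" by blast
    then have "Y \<times> Y \<subseteq> (\<Union>Y\<in>C. Y \<times> Y)" by blast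
    with Y(2) C(4) show ?thesis by (meson subset_trans)
  qed
  ultimately show ?thesis by (auto simp: cauchy_def)
qed

context ultrametric_field
begin

text \<open>The way in which the Cauchy property is used: apply it to the cover by an open disc and
  the complement of a slightly smaller concentric closed disc. For a cover by two sets
  \<open>U\<close> and \<open>W\<close>, any \<open>Y\<close> with \<open>Y \<times> Y \<subseteq> U \<times> U \<union> W \<times> W\<close> lies in \<open>U\<close> or in \<open>W\<close>.\<close>

lemma cauchy_dichotomy:
  assumes F: "cauchy av F" and s: "0 < s" "s < s'"
  shows "Pt ` odisc a s' \<in> filter_sets F \<or> - Pt ` cdisc a s \<in> filter_sets F"
proof -
  \<comment> \<open>The radii of the cover have to be values, so they are chosen between s and s'.\<close>
  obtain t where t: "s < t" "t < s'" "t \<in> value_group av" using value_group_dense_set[OF s] .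
  obtain t' where t': "t < t'" "t' < s'" "t' \<in> value_group av"
    using value_group_dense_set[OF _ t(2)] t(1) s(1) by auto
  define U where "U = Pt ` odisc a t'"
  define W where "W = - Pt ` cdisc a t"
  define C where "C = {U, W}"
  have "proj_open_ball av U" "proj_open_ball av W"
    unfolding proj_open_ball_def open_ball_def closed_ball_def U_def W_def using t(3) t'(3) by blast+
  then have aff: "open_affinoid av Y" if "Y \<in> C" for Y
    using that unfolding open_affinoid_def C_def by (intro exI[of _ "{Y}"]) auto
  have "x \<in> U \<union> W" for x
    using t'(1) by (cases x) (auto simp: U_def W_def)
  then have "\<Union>C = UNIV" by (auto simp: C_def)
  with aff have "entourage av (\<Union>Y\<in>C. Y \<times> Y)"
    unfolding entourage_def by (intro exI[of _ C]) (auto simp: C_def)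
  then obtain Y where Y: "Y \<in> filter_sets F" "Y \<times> Y \<subseteq> (\<Union>Y\<in>C. Y \<times> Y)"
    using F by (auto simp: cauchy_def)
  have "Y \<subseteq> U \<or> Y \<subseteq> W"
  proof (rule ccontr)
    assume "\<not> ?thesis"
    then obtain p q where pq: "p \<in> Y" "p \<notin> U" "q \<in> Y" "q \<notin> W" by blast
    then have "(p, q) \<in> (\<Union>Y\<in>C. Y \<times> Y)" using Y(2) by blast
    with pq show False by (simp add: C_def)
  qed
  moreover have "U \<subseteq> Pt ` odisc a s'" "W \<subseteq> - Pt ` cdisc a s"
    using t(1) t'(2) by (auto simp: U_def W_def)
  ultimately show ?thesis using filter_sets_upward[OF Y(1)] by (metis subset_trans)
qed

end

section \<open>Convergence\<close>

context ultrametric_abs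
begin

lemma chordal_Pt_Pt: "chordal av (Pt z) (Pt w) = av (z - w) / (max (av z) 1 * max (av w) 1)"
  by (simp add: chordal_def)

lemma chordal_Infty_Pt: "chordal av Infty (Pt w) = 1 / max (av w) 1"
  by (simp add: chordal_def)

lemma chordal_Pt_Infty: "chordal av (Pt w) Infty = 1 / max (av w) 1"
  by (simp add: chordal_def)

lemma le_nhdsin_iff:
  "F \<le> nhdsin (proj_topology av) P \<longleftrightarrow> (\<forall>e>0. {Q. chordal av P Q < e} \<in> filter_sets F)"
proof -
  interpret Metric_space UNIV "chordal av" by (rule Metric_space_chordal)
  have ball: "mball P e = {Q. chordal av P Q < e}" for e by auto
  show ?thesis
  proof
    assume le: "F \<le> nhdsin mtopology P"
    show "\<forall>e>0. {Q. chordal av P Q < e} \<in> filter_sets F"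
    proof clarify
      fix e :: real assume "0 < e"
      then have "eventually (\<lambda>x. x \<in> mball P e) (nhdsin mtopology P)"
        by (subst eventually_nhdsin) (metis UNIV_I centre_in_mball_iff openin_mball)
      with le show "{Q. chordal av P Q < e} \<in> filter_sets F"
        by (auto simp: filter_sets_iff ball dest: filter_leD)
    qed
  next
    assume *: "\<forall>e>0. {Q. chordal av P Q < e} \<in> filter_sets F"
    show "F \<le> nhdsin mtopology P"
    proof (rule filter_leI)
      fix Q assume "eventually Q (nhdsin mtopology P)"
      then obtain S where S: "openin mtopology S" "P \<in> S" "\<forall>x\<in>S. Q x"
        unfolding eventually_nhdsin topspace_mtopology by blast
      then obtain e where "0 < e" "mball P e \<subseteq> S"
        unfolding openin_mtopology by blast
      with S(3) have "0 < e" "mball P e \<subseteq> Collect Q" by blast+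
      with * show "eventually Q F"
        using filter_sets_upward[of "mball P e" F "Collect Q"] by (auto simp: filter_sets_iff ball)
    qed
  qed
qed

lemma converges_to_Pt_iff:
  "F \<le> nhdsin (proj_topology av) (Pt z) \<longleftrightarrow> (\<forall>r>0. Pt ` odisc z r \<in> filter_sets F)"
  unfolding le_nhdsin_iff
proof safe
  fix r :: real
  assume *: "\<forall>e>0. {Q. chordal av (Pt z) Q < e} \<in> filter_sets F" and r: "0 < r"
  define M where "M = max (av z) 1"
  have M: "1 \<le> M" "av z \<le> M" by (auto simp: M_def)
  \<comment> \<open>The bound 1 / M keeps w away from infinity: it forces av w to be at most M. Then
    the chordal distance is at least the distance divided by the square of M.\<close>
  define e where "e = min (1 / M) (r / (M * M))"
  have e: "0 < e" "e \<le> 1 / M" "e \<le> r / (M * M)" using M r by (auto simp: e_def)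
  have "{Q. chordal av (Pt z) Q < e} \<subseteq> Pt ` odisc z r"
  proof clarify
    fix Q assume Q: "chordal av (Pt z) Q < e"
    show "Q \<in> Pt ` odisc z r"
    proof (cases Q)
      case Infty
      then show ?thesis using Q e by (simp add: chordal_Pt_Infty M_def)
    next
      case (Pt w)
      have d: "av (z - w) / (M * max (av w) 1) < e" using Q by (simp add: Pt chordal_Pt_Pt M_def)
      have "av w \<le> M"
      proof (rule ccontr)
        assume "\<not> av w \<le> M"
        then have w: "M < av w" by simp
        then have "av (z - w) = av w"
          using dist_isosceles[of 0 z w] M(2) dist_sym[of z w] by simp
        then show False using d e(2) w M by (simp add: max_def)
      qed
      then have "M * max (av w) 1 \<le> M * M" "0 < M * max (av w) 1" using M by auto
      then have "av (z - w) / (M * M) \<le> av (z - w) / (M * max (av w) 1)"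
        by (intro divide_left_mono av_nonneg) (use M in auto)
      then have "av (z - w) / (M * M) < r / (M * M)" using d e(3) by linarith
      then have "av (z - w) < r" using M by (simp add: divide_less_cancel)
      then show ?thesis by (simp add: Pt dist_sym)
    qed
  qed
  with * e show "Pt ` odisc z r \<in> filter_sets F" using filter_sets_upward by blast
next
  fix e :: real
  assume *: "\<forall>r>0. Pt ` odisc z r \<in> filter_sets F" and e: "0 < e"
  have "Pt ` odisc z e \<subseteq> {Q. chordal av (Pt z) Q < e}"
  proof clarsimp
    fix w assume w: "av (w - z) < e"
    have "1 * 1 \<le> max (av z) 1 * max (av w) 1" by (intro mult_mono) auto
    then have "av (z - w) / (max (av z) 1 * max (av w) 1) \<le> av (z - w) / 1"
      by (intro divide_left_mono av_nonneg) auto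
    with w show "chordal av (Pt z) (Pt w) < e" by (simp add: chordal_Pt_Pt dist_sym)
  qed
  with * e show "{Q. chordal av (Pt z) Q < e} \<in> filter_sets F" using filter_sets_upward by blast
qed

lemma converges_to_Infty_iff:
  "F \<le> nhdsin (proj_topology av) Infty \<longleftrightarrow> (\<forall>r>0. - Pt ` cdisc 0 r \<in> filter_sets F)"
  unfolding le_nhdsin_iff
proof (intro iffI allI impI)
  fix r :: real
  assume *: "\<forall>e>0. {Q. chordal av Infty Q < e} \<in> filter_sets F" and r: "0 < r"
  define e where "e = 1 / max r 1"
  have e: "0 < e" using r by (simp add: e_def)
  have "{Q. chordal av Infty Q < e} \<subseteq> - Pt ` cdisc 0 r"
    using r by (auto simp: chordal_Infty_Pt e_def divide_simps max_def split: if_splits)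
  with * e show "- Pt ` cdisc 0 r \<in> filter_sets F" using filter_sets_upward by blast
next
  fix e :: real
  assume *: "\<forall>r>0. - Pt ` cdisc 0 r \<in> filter_sets F" and e: "0 < e"
  have "- Pt ` cdisc 0 (1 / e) \<subseteq> {Q. chordal av Infty Q < e}"
  proof
    fix Q assume Q: "Q \<in> - Pt ` cdisc 0 (1 / e)"
    show "Q \<in> {Q. chordal av Infty Q < e}"
    proof (cases Q)
      case Infty
      then show ?thesis using e by (simp add: chordal_def)
    next
      case (Pt w)
      then have "1 / e < av w" using Q by auto
      then have "1 / e < max (av w) 1" by simp
      then show ?thesis using e by (simp add: Pt chordal_Infty_Pt divide_simps mult.commute)
    qed
  qed
  moreover have "- Pt ` cdisc 0 (1 / e) \<in> filter_sets F" using *[rule_format, of "1 / e"] e by simp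
  ultimately show "{Q. chordal av Infty Q < e} \<in> filter_sets F" by (metis filter_sets_upward)
qed

text \<open>This form of convergence, in terms of discs of \<open>K\<close>, is the only one used from here on.\<close>

lemma proj_convergent_iff:
  "proj_convergent av F \<longleftrightarrow> (\<exists>z. \<forall>r>0. Pt ` odisc z r \<in> filter_sets F)
     \<or> (\<forall>r>0. - Pt ` cdisc 0 r \<in> filter_sets F)"
proof -
  have "(\<exists>P. Q P) \<longleftrightarrow> (\<exists>z. Q (Pt z)) \<or> Q Infty" for Q :: "'k proj_line \<Rightarrow> bool"
    by (metis proj_line.exhaust)
  then show ?thesis
    by (simp only: proj_convergent_def converges_to_Pt_iff converges_to_Infty_iff)
qed

end

section \<open>The filter of a closed disc\<close>

lemma Pt_image_Int: "Pt ` (S \<inter> T) = Pt ` S \<inter> Pt ` T"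
  by auto

context ultrametric_field
begin

text \<open>Since the outer radius is measured from one fixed centre, the intersection of two such discs
  contains a third, with the larger inner and the smaller outer radius. The affinoids of
  the theorem are discs of this shape, and an annulus is one with a single perforation.\<close>

definition perforated_disc :: "'k \<Rightarrow> real \<Rightarrow> 'k set \<Rightarrow> real \<Rightarrow> 'k set" where
  "perforated_disc a r' A r = odisc a r' - (\<Union>b\<in>A. cdisc b r)"

lemma in_perforated_disc:
  "z \<in> perforated_disc a r' A r \<longleftrightarrow> av (z - a) < r' \<and> (\<forall>b\<in>A. r < av (z - b))"
  by (auto simp: perforated_disc_def not_le)

text \<open>The point of the completion attached to the closed disc of radius \<open>\<rho>\<close> around \<open>a\<close>. The radii are
  arbitrary reals, so that rational and irrational discs are treated together.\<close>

definition disc_filter :: "'k \<Rightarrow> real \<Rightarrow> 'k proj_line filter" where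
  "disc_filter a \<rho> = (INF X\<in>{Pt ` perforated_disc a r' A r | r' A r.
     finite A \<and> A \<subseteq> cdisc a \<rho> \<and> 0 < r \<and> r < \<rho> \<and> \<rho> < r'}. principal X)"

lemma filter_sets_disc_filter_iff:
  assumes "0 < \<rho>"
  shows "S \<in> filter_sets (disc_filter a \<rho>) \<longleftrightarrow> (\<exists>r' A r. finite A \<and> A \<subseteq> cdisc a \<rho> \<and>
    0 < r \<and> r < \<rho> \<and> \<rho> < r' \<and> Pt ` perforated_disc a r' A r \<subseteq> S)"
proof -
  let ?\<B> = "{Pt ` perforated_disc a r' A r | r' A r.
     finite A \<and> A \<subseteq> cdisc a \<rho> \<and> 0 < r \<and> r < \<rho> \<and> \<rho> < r'}"
  have "filter_base ?\<B> (disc_filter a \<rho>)"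
    unfolding disc_filter_def
  proof (rule filter_base_INF_principal)
    have "Pt ` perforated_disc a (\<rho> + 1) {} (\<rho> / 2) \<in> ?\<B>"
      using assms by (intro CollectI exI conjI) (rule refl, auto)
    then show "?\<B> \<noteq> {}" by blast
    fix X Y assume "X \<in> ?\<B>" "Y \<in> ?\<B>"
    then obtain r' A r s' B s where X: "X = Pt ` perforated_disc a r' A r" "finite A"
        "A \<subseteq> cdisc a \<rho>" "0 < r" "r < \<rho>" "\<rho> < r'"
      and Y: "Y = Pt ` perforated_disc a s' B s" "finite B"
        "B \<subseteq> cdisc a \<rho>" "0 < s" "s < \<rho>" "\<rho> < s'"
      by auto
    have "Pt ` perforated_disc a (min r' s') (A \<union> B) (max r s) \<in> ?\<B>"
      using X Y by (intro CollectI exI conjI) (rule refl, auto)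
    moreover have "perforated_disc a (min r' s') (A \<union> B) (max r s)
        \<subseteq> perforated_disc a r' A r \<inter> perforated_disc a s' B s"
      by (auto simp: in_perforated_disc)
    then have "Pt ` perforated_disc a (min r' s') (A \<union> B) (max r s) \<subseteq> X \<inter> Y"
      unfolding X(1) Y(1) Pt_image_Int[symmetric] by (rule image_mono)
    ultimately show "\<exists>Z\<in>?\<B>. Z \<subseteq> X \<inter> Y" by blast
  qed
  then show ?thesis
    unfolding filter_base_filter_sets_iff[OF \<open>filter_base ?\<B> (disc_filter a \<rho>)\<close>] by blast
qed

lemma perforated_disc_in_disc_filter:
  assumes "finite A" "A \<subseteq> cdisc a \<rho>" "0 < r" "r < \<rho>" "\<rho> < r'"
  shows "Pt ` perforated_disc a r' A r \<in> filter_sets (disc_filter a \<rho>)"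
proof -
  have "0 < \<rho>" using assms(3,4) by simp
  from filter_sets_disc_filter_iff[OF this] assms show ?thesis by blast
qed

lemma in_disc_filterI:
  assumes "finite A" "A \<subseteq> cdisc a \<rho>" "0 < r" "r < \<rho>" "\<rho> < r'"
    and "Pt ` perforated_disc a r' A r \<subseteq> S"
  shows "S \<in> filter_sets (disc_filter a \<rho>)"
  using perforated_disc_in_disc_filter[OF assms(1-5)] assms(6) by (rule filter_sets_upward)

lemma odisc_in_disc_filter:
  assumes "0 < \<rho>" "\<rho> < r'"
  shows "Pt ` odisc a r' \<in> filter_sets (disc_filter a \<rho>)"
  by (rule in_disc_filterI[of "{}" _ _ "\<rho> / 2" r']) (use assms in \<open>auto simp: in_perforated_disc\<close>)

lemma compl_cdisc_in_disc_filter: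
  assumes "av (b - a) \<le> \<rho>" "0 < r" "r < \<rho>"
  shows "- Pt ` cdisc b r \<in> filter_sets (disc_filter a \<rho>)"
  by (rule in_disc_filterI[of "{b}" _ _ r "\<rho> + 1"]) (use assms in \<open>auto simp: in_perforated_disc\<close>)

text \<open>A perforated disc is a finite intersection of larger concentric open discs and complements of
  smaller closed discs inside, so these sets generate the filter.\<close>

lemma filter_sets_disc_filter_subsetI:
  assumes "0 < \<rho>"
    and outer: "\<And>r'. \<rho> < r' \<Longrightarrow> Pt ` odisc a r' \<in> filter_sets F"
    and inner: "\<And>b r. av (b - a) \<le> \<rho> \<Longrightarrow> 0 < r \<Longrightarrow> r < \<rho> \<Longrightarrow> - Pt ` cdisc b r \<in> filter_sets F"
  shows "filter_sets (disc_filter a \<rho>) \<subseteq> filter_sets F"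
proof
  fix S assume "S \<in> filter_sets (disc_filter a \<rho>)"
  then obtain r' A r where *: "finite A" "A \<subseteq> cdisc a \<rho>" "0 < r" "r < \<rho>" "\<rho> < r'"
      "Pt ` perforated_disc a r' A r \<subseteq> S"
    unfolding filter_sets_disc_filter_iff[OF assms(1)] by blast
  have "(\<Inter>b\<in>A. - Pt ` cdisc b r) \<in> filter_sets F"
    using * by (intro filter_sets_INT inner) auto
  with outer[OF *(5)] have "Pt ` odisc a r' \<inter> (\<Inter>b\<in>A. - Pt ` cdisc b r) \<in> filter_sets F"
    by (rule filter_sets_Int)
  moreover have "Pt ` odisc a r' \<inter> (\<Inter>b\<in>A. - Pt ` cdisc b r) \<subseteq> Pt ` perforated_disc a r' A r"
    by (force simp: in_perforated_disc)
  ultimately show "S \<in> filter_sets F" using *(6) filter_sets_upward by metis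
qed

text \<open>Since the value group is dense, some \<open>v\<close> has value between \<open>\<rho>\<close> and \<open>r'\<close>; the point \<open>a + v\<close> is then at
  distance \<open>av v\<close> from all points of the closed disc.\<close>

lemma perforated_disc_avoid_cdisc:
  assumes "A \<subseteq> cdisc a \<rho>" "r < \<rho>" "0 < \<rho>" "\<rho> < r'"
  obtains z where "z \<in> perforated_disc a r' A r" "\<rho> < av (z - a)"
proof -
  obtain v where v: "\<rho> < av v" "av v < r'" using value_group_dense[OF assms(3,4)] .
  have "r < av (a + v - b)" if "b \<in> A" for b
  proof -
    have "av (b - a) \<le> \<rho>" using that assms(1) by auto
    then have "av (v - (b - a)) = av v"
      using dist_isosceles[of 0 "b - a" v] v dist_sym[of b a] by simp
    moreover have "a + v - b = v - (b - a)" by simp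
    ultimately show ?thesis using v assms(2) by (simp only:)
  qed
  with v that[of "a + v"] show thesis by (simp add: in_perforated_disc)
qed

text \<open>The branches at the point defined by a disc of rational radius: the maximal open discs inside it
  and the complement of the disc. They correspond to the points of the projective line over the
  residue field. At a disc of irrational radius no branch is an open ball, hence the condition that
  \<open>\<rho>\<close> be a value. The open discs of radius \<open>\<rho>\<close> outside the closed disc are included as well, since the same
  argument shows that finitely many of all these sets do not cover a set of the filter.\<close>

definition directions :: "'k \<Rightarrow> real \<Rightarrow> 'k proj_line set set" where
  "directions a \<rho> = {T. \<rho> \<in> value_group av \<and>
     (T = - Pt ` cdisc a \<rho> \<or> (\<exists>c. T = Pt ` odisc c \<rho>))}"

text \<open>For rational \<open>\<rho>\<close> a finite union of branches misses a point of every perforated disc, because a point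
  of the disc can be chosen at distance at least \<open>\<rho>\<close> from the perforations and from the centres of the
  branches. For irrational \<open>\<rho>\<close> the union is empty.\<close>

lemma Union_directions_notin_disc_filter:
  assumes \<rho>: "0 < \<rho>" and fin: "finite \<T>" and sub: "\<T> \<subseteq> directions a \<rho>"
  shows "\<Union>\<T> \<notin> filter_sets (disc_filter a \<rho>)"
proof
  assume "\<Union>\<T> \<in> filter_sets (disc_filter a \<rho>)"
  then obtain r' A r where *: "finite A" "A \<subseteq> cdisc a \<rho>" "0 < r" "r < \<rho>" "\<rho> < r'"
      "Pt ` perforated_disc a r' A r \<subseteq> \<Union>\<T>"
    unfolding filter_sets_disc_filter_iff[OF \<rho>] by blast
  show False
  proof (cases "\<rho> \<in> value_group av")
    case False
    then have "\<Union>\<T> = {}" using sub by (auto simp: directions_def)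
    moreover obtain z where "z \<in> perforated_disc a r' A r"
      using perforated_disc_avoid_cdisc[OF *(2,4) \<rho> *(5)] .
    ultimately show False using *(6) by blast
  next
    case True
    have "\<forall>T\<in>\<T>. \<exists>c. T = - Pt ` cdisc a \<rho> \<or> T = Pt ` odisc c \<rho>"
      using sub by (auto simp: directions_def)
    then obtain c where c: "\<And>T. T \<in> \<T> \<Longrightarrow> T = - Pt ` cdisc a \<rho> \<or> T = Pt ` odisc (c T) \<rho>"
      by metis
    obtain z where z: "z \<in> cdisc a \<rho>" "\<And>b. b \<in> A \<union> c ` \<T> \<Longrightarrow> \<rho> \<le> av (z - b)"
      using cdisc_avoid_finite[OF True, of "A \<union> c ` \<T>" a] *(1) fin by auto
    have "r < av (z - b)" if "b \<in> A" for b
      using z(2)[of b] that *(4) by auto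
    then have "z \<in> perforated_disc a r' A r"
      using z(1) *(5) by (auto simp: in_perforated_disc)
    then have "Pt z \<in> \<Union>\<T>" using *(6) by blast
    then obtain T where T: "T \<in> \<T>" "Pt z \<in> T" by blast
    from c[OF T(1)] show False
    proof
      assume "T = - Pt ` cdisc a \<rho>"
      with T(2) z(1) show False by simp
    next
      assume "T = Pt ` odisc (c T) \<rho>"
      with T(2) have "Pt z \<in> Pt ` odisc (c T) \<rho>" by simp
      then have "av (z - c T) < \<rho>" by auto
      with z(2)[of "c T"] T(1) show False by simp
    qed
  qed
qed

lemma disc_filter_neq_bot:
  assumes "0 < \<rho>"
  shows "disc_filter a \<rho> \<noteq> bot"
  using Union_directions_notin_disc_filter[OF assms, of "{}" a] by (auto simp: filter_sets_iff)

text \<open>The ball or its complement is a disc with some centre \<open>c\<close> and radius \<open>s\<close>. If \<open>s \<noteq> \<rho>\<close>, this disc contains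
  an open disc around \<open>a\<close> of radius greater than \<open>\<rho>\<close>, or misses one, or is contained in a possible
  perforation. If \<open>s = \<rho>\<close>, it may fail all three and is then an open disc of radius \<open>\<rho>\<close>, or the closed
  disc itself.\<close>

lemma disc_filter_decides:
  assumes \<rho>: "0 < \<rho>" and U: "proj_open_ball av U"
  shows "U \<in> filter_sets (disc_filter a \<rho>) \<or> - U \<in> filter_sets (disc_filter a \<rho>) \<or>
    U \<in> directions a \<rho>"
proof -
  let ?F = "filter_sets (disc_filter a \<rho>)"
  have far: "- Pt ` S \<in> ?F" if "\<rho> < d" "S \<inter> odisc a d = {}" for S d
    using odisc_in_disc_filter[OF \<rho> that(1), of a] by (rule filter_sets_upward) (use that in auto)
  have big: "Pt ` S \<in> ?F" if "\<rho> < d" "odisc a d \<subseteq> S" for S d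
    using odisc_in_disc_filter[OF \<rho> that(1), of a] by (rule filter_sets_upward) (use that in auto)
  from U consider c s where "s \<in> value_group av" "U = Pt ` odisc c s"
    | c s where "s \<in> value_group av" "U = - Pt ` cdisc c s"
    unfolding proj_open_ball_def open_ball_def closed_ball_def by blast
  then show ?thesis
  proof cases
    case 1
    then have s: "0 < s" by (simp add: value_group_iff)
    consider "\<rho> < s" "av (a - c) < s" | "s \<le> av (a - c)" "\<rho> < av (a - c)"
      | "av (c - a) \<le> \<rho>" "s < \<rho>" | "s = \<rho>"
      using dist_sym[of a c] by linarith
    then show ?thesis
    proof cases
      case 1
      have "odisc c s = odisc a s" using 1(2) by (intro odisc_recenter) simp
      then have "odisc a s \<subseteq> odisc c s" by (simp only: order_refl)
      then show ?thesis using big[OF 1(1)] \<open>U = _\<close> by simp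
    next
      case 2
      have "odisc c s \<inter> odisc a (av (a - c)) = {}"
      proof (rule ccontr)
        assume "\<not> ?thesis"
        then obtain z where "av (z - c) < s" "av (z - a) < av (a - c)" by auto
        then show False using dist_less[of a z "av (a - c)" c] 2(1) dist_sym[of a z] by simp
      qed
      then show ?thesis using far[OF 2(2)] \<open>U = _\<close> by simp
    next
      case 3
      have "- Pt ` cdisc c s \<subseteq> - U" using \<open>U = _\<close> by auto
      then show ?thesis
        using compl_cdisc_in_disc_filter[OF 3(1) s 3(2)] filter_sets_upward by blast
    next
      case 4
      then show ?thesis using 1 by (auto simp: directions_def)
    qed
  next
    case 2
    then have s: "0 < s" by (simp add: value_group_iff)
    consider "\<rho> < s" "av (a - c) \<le> s" | "s < av (a - c)" "\<rho> < av (a - c)"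
      | "av (c - a) \<le> \<rho>" "s < \<rho>" | "s = \<rho>" "av (a - c) \<le> \<rho>"
      using dist_sym[of a c] by linarith
    then show ?thesis
    proof cases
      case 1
      have "cdisc c s = cdisc a s" using 1(2) by (intro cdisc_recenter) simp
      moreover have "odisc a s \<subseteq> cdisc a s" by auto
      ultimately have "odisc a s \<subseteq> cdisc c s" by (simp only:)
      then show ?thesis using big[OF 1(1)] \<open>U = _\<close> by simp
    next
      case 2
      have "cdisc c s \<inter> odisc a (av (a - c)) = {}"
      proof (rule ccontr)
        assume "\<not> ?thesis"
        then obtain z where "av (z - c) \<le> s" "av (z - a) < av (a - c)" by auto
        then show False using dist_less[of a z "av (a - c)" c] 2(1) dist_sym[of a z] by simp
      qed
      then show ?thesis using far[OF 2(2)] \<open>U = _\<close> by simp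
    next
      case 3
      then show ?thesis using compl_cdisc_in_disc_filter[OF 3(1) s 3(2)] \<open>U = _\<close> by simp
    next
      case 4
      have "cdisc c s = cdisc a s" using 4 by (intro cdisc_recenter) simp
      then have "U = - Pt ` cdisc a \<rho>" using \<open>U = _\<close> 4(1) by (simp only:)
      then show ?thesis using 2 4(1) by (auto simp: directions_def)
    qed
  qed
qed

lemma cauchy_disc_filter: "0 < \<rho> \<Longrightarrow> cauchy av (disc_filter a \<rho>)"
  using disc_filter_decides Union_directions_notin_disc_filter by (rule cauchyI)

lemma cauchyD_neq_bot: "cauchy av F \<Longrightarrow> F \<noteq> bot"
  by (simp add: cauchy_def)

lemma filter_sets_not_both:
  assumes "F \<noteq> bot" "X \<in> filter_sets F" "Y \<in> filter_sets F" "X \<inter> Y = {}"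
  shows False
  using filter_sets_meet[OF assms(1-3)] assms(4) by blast

text \<open>A Cauchy filter contained in the filter of the disc satisfies the dichotomy for concentric discs.
  On discs with radii on the same side of \<open>\<rho>\<close>, one of its alternatives is excluded already in the
  larger filter, so the other one puts each generator into the smaller filter.\<close>

lemma minimal_cauchy_disc_filter:
  assumes \<rho>: "0 < \<rho>"
  shows "minimal_cauchy av (disc_filter a \<rho>)"
  unfolding minimal_cauchy_def
proof (intro conjI allI impI)
  show "cauchy av (disc_filter a \<rho>)" using \<rho> by (rule cauchy_disc_filter)
  fix G assume G: "cauchy av G \<and> filter_sets G \<subseteq> filter_sets (disc_filter a \<rho>)"
  note not_both = filter_sets_not_both[OF disc_filter_neq_bot[OF \<rho>, of a]]
  have "filter_sets (disc_filter a \<rho>) \<subseteq> filter_sets G"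
  proof (rule filter_sets_disc_filter_subsetI[OF \<rho>])
    fix r' assume r': "\<rho> < r'"
    define s where "s = (\<rho> + r') / 2"
    have s: "0 < s" "\<rho> < s" "s < r'" using r' \<rho> by (auto simp: s_def)
    have "- Pt ` cdisc a s \<notin> filter_sets G"
    proof
      assume "- Pt ` cdisc a s \<in> filter_sets G"
      with G have "- Pt ` cdisc a s \<in> filter_sets (disc_filter a \<rho>)" by blast
      then show False using odisc_in_disc_filter[OF \<rho> s(2), of a]
        by (rule not_both) auto
    qed
    then show "Pt ` odisc a r' \<in> filter_sets G"
      using cauchy_dichotomy[of G s r' a] G s by blast
  next
    fix b r assume b: "av (b - a) \<le> \<rho>" and r: "0 < r" "r < \<rho>"
    define s where "s = (r + \<rho>) / 2"
    have s: "0 < s" "r < s" "s < \<rho>" using r by (auto simp: s_def)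
    have "Pt ` odisc b s \<notin> filter_sets G"
    proof
      assume "Pt ` odisc b s \<in> filter_sets G"
      with G have "Pt ` odisc b s \<in> filter_sets (disc_filter a \<rho>)" by blast
      then show False using compl_cdisc_in_disc_filter[OF b s(1,3)]
        by (rule not_both) auto
    qed
    then show "- Pt ` cdisc b r \<in> filter_sets G"
      using cauchy_dichotomy[of G r s b] G r s by blast
  qed
  with G show "G = disc_filter a \<rho>"
    using filter_sets_inject[of G "disc_filter a \<rho>"] by blast
qed

lemma not_convergent_disc_filter:
  assumes \<rho>: "0 < \<rho>"
  shows "\<not> proj_convergent av (disc_filter a \<rho>)"
proof
  note not_both = filter_sets_not_both[OF disc_filter_neq_bot[OF \<rho>, of a]]
  assume "proj_convergent av (disc_filter a \<rho>)"
  then consider z where "\<And>r. 0 < r \<Longrightarrow> Pt ` odisc z r \<in> filter_sets (disc_filter a \<rho>)"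
    | "\<And>r. 0 < r \<Longrightarrow> - Pt ` cdisc 0 r \<in> filter_sets (disc_filter a \<rho>)"
    unfolding proj_convergent_iff by blast
  then show False
  proof cases
    case 1
    show False
    proof (cases "av (z - a) \<le> \<rho>")
      case True
      have "0 < \<rho> / 2" "\<rho> / 2 < \<rho>" using \<rho> by auto
      with 1 compl_cdisc_in_disc_filter[OF True, of "\<rho> / 2"]
      have "Pt ` odisc z (\<rho> / 2) \<in> filter_sets (disc_filter a \<rho>)"
        "- Pt ` cdisc z (\<rho> / 2) \<in> filter_sets (disc_filter a \<rho>)" by blast+
      then show False by (rule not_both) auto
    next
      case False
      then have d: "\<rho> < av (z - a)" by simp
      have "odisc z (av (z - a)) \<inter> odisc a (av (z - a)) = {}"
      proof (rule ccontr)
        assume "\<not> ?thesis"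
        then obtain w where "av (w - z) < av (z - a)" "av (w - a) < av (z - a)" by auto
        then show False using dist_less[of z w "av (z - a)" a] dist_sym[of z w] by simp
      qed
      then have "Pt ` odisc z (av (z - a)) \<inter> Pt ` odisc a (av (z - a)) = {}" by auto
      moreover have "0 < av (z - a)" using \<rho> d by simp
      ultimately show False using not_both[OF 1 odisc_in_disc_filter[OF \<rho> d]] by blast
    qed
  next
    case 2
    define R where "R = max (\<rho> + 1) (av a)"
    have R: "0 < R" "\<rho> + 1 \<le> R" "av a \<le> R" using \<rho> by (auto simp: R_def)
    have "Pt ` odisc a (\<rho> + 1) \<inter> - Pt ` cdisc 0 R = {}"
    proof -
      have "av z \<le> R" if "av (z - a) < \<rho> + 1" for z
        using dist_le[of z a R 0] that R by simp
      then show ?thesis by auto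
    qed
    moreover have "Pt ` odisc a (\<rho> + 1) \<in> filter_sets (disc_filter a \<rho>)"
      using \<rho> by (intro odisc_in_disc_filter) auto
    ultimately show False using not_both[OF _ 2[OF R(1)]] by blast
  qed
qed

text \<open>A ball that belongs to the filter contains points \<open>y\<close> and \<open>z\<close> with \<open>\<rho> < av (y - a) < av (z - a)\<close>. The
  points of the disc are closer to \<open>y\<close> than \<open>z\<close> is, so they belong to the ball. In particular no open
  disc of radius \<open>\<rho>\<close> belongs to the filter.\<close>

lemma Inter_balls_in_disc_filter:
  assumes \<rho>: "0 < \<rho>"
  shows "\<Inter>(balls_in av (disc_filter a \<rho>)) = cdisc a \<rho>"
proof (intro equalityI subsetI)
  fix z assume z: "z \<in> \<Inter>(balls_in av (disc_filter a \<rho>))"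
  show "z \<in> cdisc a \<rho>"
  proof (rule ccontr)
    assume "z \<notin> cdisc a \<rho>"
    then have "\<rho> < av (z - a)" by simp
    then obtain s where s: "\<rho> < s" "s < av (z - a)" "s \<in> value_group av"
      using value_group_dense_set[OF \<rho>] by blast
    have "is_ball av (odisc a s)" using s(3) by (auto simp: is_ball_def open_ball_def)
    then have "odisc a s \<in> balls_in av (disc_filter a \<rho>)"
      using odisc_in_disc_filter[OF \<rho> s(1)] by (simp add: balls_in_def)
    with z have "z \<in> odisc a s" by blast
    with s(2) show False by simp
  qed
next
  fix x assume x: "x \<in> cdisc a \<rho>"
  show "x \<in> \<Inter>(balls_in av (disc_filter a \<rho>))"
  proof
    fix S assume "S \<in> balls_in av (disc_filter a \<rho>)"
    then have S: "is_ball av S" "Pt ` S \<in> filter_sets (disc_filter a \<rho>)"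
      by (auto simp: balls_in_def)
    then obtain r' A r where *: "finite A" "A \<subseteq> cdisc a \<rho>" "0 < r" "r < \<rho>" "\<rho> < r'"
        "Pt ` perforated_disc a r' A r \<subseteq> Pt ` S"
      unfolding filter_sets_disc_filter_iff[OF \<rho>] by blast
    then have sub: "perforated_disc a r' A r \<subseteq> S" by auto
    obtain z where z: "z \<in> perforated_disc a r' A r" "\<rho> < av (z - a)"
      using perforated_disc_avoid_cdisc[OF *(2,4) \<rho> *(5)] .
    obtain y where y: "y \<in> perforated_disc a (av (z - a)) A r" "\<rho> < av (y - a)"
      using perforated_disc_avoid_cdisc[OF *(2,4) \<rho> z(2)] .
    then have y': "av (y - a) < av (z - a)" "y \<in> perforated_disc a r' A r"
      using z(1) by (auto simp: in_perforated_disc)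
    have zy: "av (z - y) = av (z - a)"
      using dist_isosceles[of a y z] y'(1) dist_sym[of a y] by simp
    have "av (x - y) \<le> av (z - y)"
      using dist_le[of x a "av (y - a)" y] x y(2) y'(1) zy dist_sym[of a y] by simp
    then show "x \<in> S"
      using dist_convexD[OF is_ball_imp_dist_convex[OF S(1)], of y z x] sub z(1) y'(2) by blast
  qed
qed

section \<open>Bases of the filter of a disc\<close>

lemma Min_image_less_iff:
  "0 < (k::nat) \<Longrightarrow> Min (f ` {1..k}) < (t::real) \<longleftrightarrow> (\<exists>j\<in>{1..k}. f j < t)"
  by (subst Min_less_iff) auto

lemma less_Min_image_iff:
  "0 < (k::nat) \<Longrightarrow> (t::real) < Min (f ` {1..k}) \<longleftrightarrow> (\<forall>j\<in>{1..k}. t < f j)"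
  by (subst Min_gr_iff) auto

text \<open>All \<open>c j\<close> lie within distance less than \<open>r'\<close> of \<open>a\<close>, so the open discs of radius \<open>r'\<close> around them
  are the same one.\<close>

lemma perforated_disc_eq_Min:
  assumes k: "0 < (k::nat)" and c: "\<forall>j\<in>{1..k}. av (c j - a) < r'"
  shows "{z. r < Min ((\<lambda>j. av (z - c j)) ` {1..k}) \<and> Min ((\<lambda>j. av (z - c j)) ` {1..k}) < r'}
    = perforated_disc a r' (c ` {1..k}) r"
proof -
  have "(\<exists>j\<in>{1..k}. av (z - c j) < r') \<longleftrightarrow> av (z - a) < r'" for z
  proof
    assume "\<exists>j\<in>{1..k}. av (z - c j) < r'"
    then obtain j where "j \<in> {1..k}" "av (z - c j) < r'" by blast
    with c dist_less[of z "c j" r' a] show "av (z - a) < r'" by blast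
  next
    assume z: "av (z - a) < r'"
    have "1 \<in> {1..k}" using k by simp
    moreover from this have "av (c 1 - a) < r'" using c by blast
    ultimately show "\<exists>j\<in>{1..k}. av (z - c j) < r'"
      using dist_less[of z a r' "c 1"] z dist_sym[of a "c 1"] by auto
  qed
  then show ?thesis
    unfolding Min_image_less_iff[OF k] less_Min_image_iff[OF k]
    by (auto simp: in_perforated_disc)
qed

lemma open_affinoid_perforated_disc:
  assumes "finite A" "r \<in> value_group av" "r' \<in> value_group av"
  shows "open_affinoid av (Pt ` perforated_disc a r' A r)"
  unfolding open_affinoid_def
proof (intro exI conjI)
  let ?U = "insert (Pt ` odisc a r') ((\<lambda>b. - Pt ` cdisc b r) ` A)"
  show "finite ?U" using assms(1) by simp
  show "\<forall>U\<in>?U. proj_open_ball av U"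
    unfolding proj_open_ball_def open_ball_def closed_ball_def using assms(2,3) by blast
  have "Pt ` perforated_disc a r' A r = Pt ` odisc a r' \<inter> (\<Inter>b\<in>A. - Pt ` cdisc b r)"
    by (force simp: in_perforated_disc)
  then show "Pt ` perforated_disc a r' A r = \<Inter>?U" by simp
qed

text \<open>This holds for irrational radii as well: shrinking a perforated disc slightly makes its radii
  values and thus turns it into an open affinoid. The point \<open>a\<close> is added to the perforations because
  the collection asks for at least one.\<close>

lemma filter_base_affinoid_collection:
  assumes \<rho>: "0 < \<rho>"
  shows "filter_base (affinoid_collection av (cdisc a \<rho>)) (disc_filter a \<rho>)"
  unfolding filter_base_def
proof (intro equalityI subsetI)
  fix S assume "S \<in> {S. \<exists>B\<in>affinoid_collection av (cdisc a \<rho>). B \<subseteq> S}"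
  then obtain Y where Y: "Y \<in> affinoid_collection av (cdisc a \<rho>)" "Y \<subseteq> S" by blast
  then obtain k c r r' where *: "0 < (k::nat)" "\<forall>j\<in>{1..k}. c j \<in> cdisc a \<rho>" "0 < r"
      "r < \<rho>" "\<rho> < r'" "Y = Pt ` {z. r < Min ((\<lambda>j. av (z - c j)) ` {1..k}) \<and>
                         Min ((\<lambda>j. av (z - c j)) ` {1..k}) < r'}"
    unfolding affinoid_collection_def diam_cdisc[OF \<rho>] by blast
  have "\<forall>j\<in>{1..k}. av (c j - a) < r'" using *(2,5) by fastforce
  then have "Y = Pt ` perforated_disc a r' (c ` {1..k}) r"
    unfolding *(6) by (subst perforated_disc_eq_Min[OF *(1)]) simp_all
  with Y(2) show "S \<in> filter_sets (disc_filter a \<rho>)"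
    using in_disc_filterI[of "c ` {1..k}" a \<rho> r r' S] *(2-5) by blast
next
  fix S assume "S \<in> filter_sets (disc_filter a \<rho>)"
  then obtain r' A r where *: "finite A" "A \<subseteq> cdisc a \<rho>" "0 < r" "r < \<rho>" "\<rho> < r'"
      "Pt ` perforated_disc a r' A r \<subseteq> S"
    unfolding filter_sets_disc_filter_iff[OF \<rho>] by blast
  obtain s where s: "r < s" "s < \<rho>" "s \<in> value_group av"
    using value_group_dense_set[OF *(3,4)] .
  obtain s' where s': "\<rho> < s'" "s' < r'" "s' \<in> value_group av"
    using value_group_dense_set[OF \<rho> *(5)] .
  define A' where "A' = insert a A"
  have A': "finite A'" "A' \<noteq> {}" "A' \<subseteq> cdisc a \<rho>" using * \<rho> by (auto simp: A'_def)
  obtain c where c: "bij_betw c {1..card A'} A'"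
    using ex_bij_betw_nat_finite_1[OF A'(1)] by blast
  have k: "0 < card A'" using A' by (simp add: card_gt_0_iff)
  have cA: "c ` {1..card A'} = A'" using c by (simp add: bij_betw_def)
  define Y where "Y = Pt ` perforated_disc a s' A' s"
  have cj: "\<forall>j\<in>{1..card A'}. c j \<in> cdisc a \<rho>" using cA A'(3) by blast
  then have cs: "\<forall>j\<in>{1..card A'}. av (c j - a) < s'" using s'(1) by fastforce
  have "Y = Pt ` {z. s < Min ((\<lambda>j. av (z - c j)) ` {1..card A'}) \<and>
                         Min ((\<lambda>j. av (z - c j)) ` {1..card A'}) < s'}"
    unfolding Y_def perforated_disc_eq_Min[OF k cs] cA ..
  moreover have "open_affinoid av Y"
    unfolding Y_def using A'(1) s(3) s'(3) by (rule open_affinoid_perforated_disc)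
  moreover have "0 < s" using s(1) *(3) by simp
  ultimately have "Y \<in> affinoid_collection av (cdisc a \<rho>)"
    unfolding affinoid_collection_def diam_cdisc[OF \<rho>] using k cj s(2) s'(1) by blast
  moreover have "perforated_disc a s' A' s \<subseteq> perforated_disc a r' A r"
    using s(1) s'(2) by (fastforce simp: in_perforated_disc A'_def)
  then have "Y \<subseteq> S" unfolding Y_def using *(6) by blast
  ultimately show "S \<in> {S. \<exists>B\<in>affinoid_collection av (cdisc a \<rho>). B \<subseteq> S}" by blast
qed

text \<open>If \<open>\<rho>\<close> is not a value, finitely many points of the disc are at distance less than \<open>\<rho>\<close> from \<open>a\<close>, with a
  maximum \<open>t < \<rho>\<close>. So the perforations of a perforated disc fit in the hole of a single annulus.\<close>

lemma filter_base_annulus_collection: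
  assumes \<rho>: "0 < \<rho>" "\<rho> \<notin> value_group av"
  shows "filter_base (annulus_collection av (cdisc a \<rho>)) (disc_filter a \<rho>)"
  unfolding filter_base_def
proof (intro equalityI subsetI)
  fix S assume "S \<in> {S. \<exists>B\<in>annulus_collection av (cdisc a \<rho>). B \<subseteq> S}"
  then obtain b r r' where *: "b \<in> cdisc a \<rho>" "0 < r" "r < \<rho>" "\<rho> < r'"
      "Pt ` {z. r < av (z - b) \<and> av (z - b) < r'} \<subseteq> S"
    unfolding annulus_collection_def diam_cdisc[OF \<rho>(1)] by blast
  have "odisc a r' = odisc b r'" using *(1,4) by (intro odisc_recenter) simp
  then have "av (z - b) < r'" if "av (z - a) < r'" for z
    using that by blast
  then have "perforated_disc a r' {b} r \<subseteq> {z. r < av (z - b) \<and> av (z - b) < r'}"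
    by (auto simp: in_perforated_disc)
  then have "Pt ` perforated_disc a r' {b} r \<subseteq> S" using *(5) by blast
  then show "S \<in> filter_sets (disc_filter a \<rho>)"
    using in_disc_filterI[of "{b}" a \<rho> r r' S] * by simp
next
  fix S assume "S \<in> filter_sets (disc_filter a \<rho>)"
  then obtain r' A r where *: "finite A" "A \<subseteq> cdisc a \<rho>" "0 < r" "r < \<rho>" "\<rho> < r'"
      "Pt ` perforated_disc a r' A r \<subseteq> S"
    unfolding filter_sets_disc_filter_iff[OF \<rho>(1)] by blast
  define T where "T = insert r ((\<lambda>b. av (b - a)) ` A)"
  define t where "t = Max T"
  have finT: "finite T" "T \<noteq> {}" using *(1) by (auto simp: T_def)
  have less: "x < \<rho>" if "x \<in> T" for x
  proof -
    from that consider "x = r" | b where "b \<in> A" "x = av (b - a)" by (auto simp: T_def)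
    then show ?thesis
    proof cases
      case 2
      then have "x \<le> \<rho>" using *(2) by auto
      moreover have "x \<noteq> \<rho>" using \<rho> av_in_value_group[of "b - a"] 2 by auto
      ultimately show ?thesis by simp
    qed (use *(4) in simp)
  qed
  then have t: "t < \<rho>" using Max_in[OF finT] by (simp add: t_def)
  have rt: "r \<le> t" unfolding t_def using finT by (intro Max_ge) (auto simp: T_def)
  have "{z. t < av (z - a) \<and> av (z - a) < r'} \<subseteq> perforated_disc a r' A r"
  proof clarify
    fix z assume z: "t < av (z - a)" "av (z - a) < r'"
    have "r < av (z - b)" if "b \<in> A" for b
    proof -
      have "av (b - a) \<le> t" unfolding t_def using finT that by (intro Max_ge) (auto simp: T_def)
      then have "av (z - b) = av (z - a)"
        using dist_isosceles[of a b z] z(1) dist_sym[of a b] by simp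
      with z(1) rt show ?thesis by simp
    qed
    with z(2) show "z \<in> perforated_disc a r' A r" by (simp add: in_perforated_disc)
  qed
  then have "Pt ` {z. t < av (z - a) \<and> av (z - a) < r'} \<subseteq> S" using *(6) by blast
  moreover have "Pt ` {z. t < av (z - a) \<and> av (z - a) < r'} \<in> annulus_collection av (cdisc a \<rho>)"
    unfolding annulus_collection_def diam_cdisc[OF \<rho>(1)]
    using t rt *(3,5) \<rho>(1) by (intro CollectI exI[of _ a] exI[of _ t] exI[of _ r'] conjI) auto
  ultimately show "S \<in> {S. \<exists>B\<in>annulus_collection av (cdisc a \<rho>). B \<subseteq> S}" by blast
qed

section \<open>Nested sequences of balls\<close>

definition sequence_filter :: "(nat \<Rightarrow> 'k set) \<Rightarrow> 'k proj_line filter" where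
  "sequence_filter S = (INF X\<in>range (\<lambda>n. Pt ` S n). principal X)"

lemma filter_base_sequence_filter:
  assumes "decseq S"
  shows "filter_base (range (\<lambda>n. Pt ` S n)) (sequence_filter S)"
  unfolding sequence_filter_def
proof (rule filter_base_INF_principal)
  fix X Y assume "X \<in> range (\<lambda>n. Pt ` S n)" "Y \<in> range (\<lambda>n. Pt ` S n)"
  then obtain m n where mn: "X = Pt ` S m" "Y = Pt ` S n" by blast
  have "S (max m n) \<subseteq> S m" "S (max m n) \<subseteq> S n"
    using assms by (auto simp: decseq_def)
  then have "Pt ` S (max m n) \<subseteq> X \<inter> Y" unfolding mn by blast
  then show "\<exists>Z\<in>range (\<lambda>n. Pt ` S n). Z \<subseteq> X \<inter> Y" by blast
qed simp

lemma filter_sets_sequence_filter_iff: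
  assumes "decseq S"
  shows "X \<in> filter_sets (sequence_filter S) \<longleftrightarrow> (\<exists>n. Pt ` S n \<subseteq> X)"
  using filter_base_filter_sets_iff[OF filter_base_sequence_filter[OF assms]] by blast

context
  fixes S :: "nat \<Rightarrow> 'k set"
  assumes ball: "\<And>n. is_ball av (S n)" and dec: "decseq S" and empty: "(\<Inter>n. S n) = {}"
begin

lemma escape: obtains n where "z \<notin> S n" "m \<le> n"
proof -
  obtain n where "z \<notin> S n" using empty by blast
  then have "z \<notin> S (max m n)" using dec by (metis decseq_def in_mono max.cobounded2)
  then show thesis using that[of "max m n"] by simp
qed

lemma sequence_filter_neq_bot: "sequence_filter S \<noteq> bot"
proof
  assume "sequence_filter S = bot"
  then have "{} \<in> filter_sets (sequence_filter S)" by (simp add: filter_sets_iff)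
  then obtain n where "S n = {}" unfolding filter_sets_sequence_filter_iff[OF dec] by blast
  then show False using is_ball_nonempty[OF ball] by blast
qed

lemma sequence_in_filter: "Pt ` S n \<in> filter_sets (sequence_filter S)"
  unfolding filter_sets_sequence_filter_iff[OF dec] by blast

text \<open>A member of the sequence that misses a point of \<open>B\<close> cannot contain \<open>B\<close>, and balls are nested or
  disjoint.\<close>

lemma eventually_inside_or_outside:
  assumes B: "dist_convex B" "B \<noteq> {}"
  obtains n where "S n \<subseteq> B" | n where "S n \<inter> B = {}"
proof -
  obtain b where b: "b \<in> B" using B(2) by blast
  obtain n where n: "b \<notin> S n" using escape .
  then have "\<not> B \<subseteq> S n" using b by blast
  then show thesis
    using dist_convex_nested[OF is_ball_imp_dist_convex[OF ball[of n]] B(1)] that by blast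
qed

lemma cauchy_sequence_filter: "cauchy av (sequence_filter S)"
proof (rule cauchyI[where \<T> = "{}"])
  fix U assume "proj_open_ball av U"
  then obtain B where B: "is_ball av B" "U = Pt ` B \<or> U = - Pt ` B"
    unfolding proj_open_ball_def is_ball_def by blast
  have "Pt ` B \<in> filter_sets (sequence_filter S) \<or> - Pt ` B \<in> filter_sets (sequence_filter S)"
    using eventually_inside_or_outside[OF is_ball_imp_dist_convex[OF B(1)] is_ball_nonempty[OF B(1)]]
  proof cases
    case (1 n)
    then show ?thesis using filter_sets_sequence_filter_iff[OF dec] by blast
  next
    case (2 n)
    then have "Pt ` S n \<subseteq> - Pt ` B" by auto
    then show ?thesis using filter_sets_sequence_filter_iff[OF dec] by blast
  qed
  with B(2) show "U \<in> filter_sets (sequence_filter S) \<or> - U \<in> filter_sets (sequence_filter S) \<or> U \<in> {}"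
    by auto
next
  fix \<T>' :: "'k proj_line set set" assume "\<T>' \<subseteq> {}"
  then show "\<Union>\<T>' \<notin> filter_sets (sequence_filter S)"
    using sequence_filter_neq_bot by (simp add: filter_sets_iff)
qed

text \<open>The radii of the balls need not decrease strictly: a closed ball may be followed by the open ball of
  the same radius. To make room for a closed disc between two members of the sequence, take
  \<open>t\<close> to be the distance from a point \<open>c\<close> of \<open>S n\<close> to a later \<open>S m\<close> that does not contain \<open>c\<close>.\<close>

lemma shrink:
  obtains b t m where "n \<le> m" "0 < t" "S m \<subseteq> odisc b t" "cdisc b t \<subseteq> S n" "b \<in> S m"
    "\<exists>c\<in>S n. t = av (c - b)"
proof -
  obtain c where c: "c \<in> S n" using is_ball_nonempty[OF ball[of n]] by blast
  obtain m where m: "c \<notin> S m" "n \<le> m" using escape .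
  obtain b where b: "b \<in> S m" using is_ball_nonempty[OF ball[of m]] by blast
  have bn: "b \<in> S n" using b m(2) dec by (auto simp: decseq_def)
  have "0 < av (c - b)" using av_pos_iff[of "c - b"] m(1) b by auto
  moreover have "S m \<subseteq> odisc b (av (c - b))"
  proof (rule subsetI, rule ccontr)
    fix z assume z: "z \<in> S m" "z \<notin> odisc b (av (c - b))"
    then have "av (c - b) \<le> av (z - b)" by simp
    then show False
      using dist_convexD[OF is_ball_imp_dist_convex[OF ball[of m]] b z(1)] m(1) by blast
  qed
  moreover have "cdisc b (av (c - b)) \<subseteq> S n"
    using dist_convexD[OF is_ball_imp_dist_convex[OF ball[of n]] bn c] by blast
  ultimately show thesis using that[of m "av (c - b)" b] m(2) b c by blast
qed

lemma minimal_cauchy_sequence_filter: "minimal_cauchy av (sequence_filter S)"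
  unfolding minimal_cauchy_def
proof (intro conjI allI impI)
  show "cauchy av (sequence_filter S)" by (rule cauchy_sequence_filter)
  fix G assume G: "cauchy av G \<and> filter_sets G \<subseteq> filter_sets (sequence_filter S)"
  have "Pt ` S n \<in> filter_sets G" for n
  proof -
    \<comment> \<open>The concentric discs needed for the dichotomy come from shrinking twice, since u
      < t.\<close>
    obtain b t m where 1: "n \<le> m" "0 < t" "S m \<subseteq> odisc b t" "cdisc b t \<subseteq> S n" "b \<in> S m"
      using shrink[of n] by metis
    obtain d u p where 2: "m \<le> p" "0 < u" "S p \<subseteq> odisc d u" "cdisc d u \<subseteq> S m" "d \<in> S p"
        "\<exists>c\<in>S m. u = av (c - d)"
      using shrink[of m] .
    then obtain c where c: "c \<in> S m" "u = av (c - d)" by blast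
    have "d \<in> S m" using 2(1,5) dec by (auto simp: decseq_def)
    then have db: "av (d - b) < t" and "av (c - b) < t" using 1(3) c(1) by auto
    then have ut: "u < t" using dist_less[of c b t d] c(2) dist_sym[of b d] by simp
    have "- Pt ` cdisc d u \<notin> filter_sets G"
    proof
      assume "- Pt ` cdisc d u \<in> filter_sets G"
      with G have "- Pt ` cdisc d u \<in> filter_sets (sequence_filter S)" by blast
      moreover have "- Pt ` cdisc d u \<inter> Pt ` S p = {}" using 2(3) by fastforce
      ultimately show False
        using filter_sets_not_both[OF sequence_filter_neq_bot _ sequence_in_filter[of p]] by blast
    qed
    then have "Pt ` odisc d t \<in> filter_sets G" using cauchy_dichotomy[of G u t d] G 2(2) ut by blast
    moreover have bd: "odisc b t = odisc d t" using db by (intro odisc_recenter) simp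
    have "odisc b t \<subseteq> cdisc b t" by auto
    then have "odisc d t \<subseteq> cdisc b t" unfolding bd .
    then have "odisc d t \<subseteq> S n" using 1(4) by (rule subset_trans)
    then have "Pt ` odisc d t \<subseteq> Pt ` S n" by blast
    ultimately show ?thesis by (rule filter_sets_upward)
  qed
  then have "filter_sets (sequence_filter S) \<subseteq> filter_sets G"
    using filter_base_imp_filter_sets_subset[OF filter_base_sequence_filter[OF dec]] by blast
  with G show "G = sequence_filter S"
    using filter_sets_inject[of G "sequence_filter S"] by blast
qed

lemma not_convergent_sequence_filter: "\<not> proj_convergent av (sequence_filter S)"
proof
  note not_both = filter_sets_not_both[OF sequence_filter_neq_bot]
  assume "proj_convergent av (sequence_filter S)"
  then consider z where "\<And>r. 0 < r \<Longrightarrow> Pt ` odisc z r \<in> filter_sets (sequence_filter S)"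
    | "\<And>r. 0 < r \<Longrightarrow> - Pt ` cdisc 0 r \<in> filter_sets (sequence_filter S)"
    unfolding proj_convergent_iff by blast
  then show False
  proof cases
    case 1
    obtain n where n: "z \<notin> S n" using escape .
    obtain b where b: "b \<in> S n" using is_ball_nonempty[OF ball[of n]] by blast
    have r: "0 < av (z - b)" using av_pos_iff[of "z - b"] n b by auto
    have "w \<notin> S n" if "av (w - z) < av (z - b)" for w
    proof
      assume w: "w \<in> S n"
      have "av (b - w) = av (b - z)"
        using that dist_sym[of z w] dist_sym[of z b] by (intro dist_isosceles) simp
      then have "av (w - b) = av (z - b)" by (metis dist_sym)
      then show False
        using dist_convexD[OF is_ball_imp_dist_convex[OF ball[of n]] b w, of z] n by simp
    qed
    then have "Pt ` odisc z (av (z - b)) \<inter> Pt ` S n = {}" by auto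
    then show False by (rule not_both[OF 1[OF r] sequence_in_filter])
  next
    case 2
    obtain r where r: "0 < r" "S 0 \<subseteq> odisc 0 r" using is_ball_bounded[OF ball[of 0]] by blast
    then have "- Pt ` cdisc 0 r \<inter> Pt ` S 0 = {}" by fastforce
    then show False by (rule not_both[OF 2[OF r(1)] sequence_in_filter])
  qed
qed

end

section \<open>Classification\<close>

lemma minimal_cauchy_eqI:
  assumes "minimal_cauchy av F" "cauchy av G" "filter_sets G \<subseteq> filter_sets F"
  shows "F = G"
  using assms unfolding minimal_cauchy_def by blast

lemma balls_in_nonempty:
  assumes "cauchy av F" "\<not> proj_convergent av F"
  shows "balls_in av F \<noteq> {}"
proof
  assume empty: "balls_in av F = {}"
  have "- Pt ` cdisc 0 r \<in> filter_sets F" if r: "0 < r" for r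
  proof -
    obtain s where s: "r < s" "s < r + 1" "s \<in> value_group av"
      using value_group_dense_set[of r "r + 1"] r by auto
    then have "is_ball av (odisc 0 s)" unfolding is_ball_def open_ball_def by blast
    then have "Pt ` odisc 0 s \<notin> filter_sets F" using empty by (auto simp: balls_in_def)
    then show ?thesis using cauchy_dichotomy[OF assms(1) r s(1), of 0] by blast
  qed
  with assms(2) show False unfolding proj_convergent_iff by blast
qed

lemma balls_in_nested:
  assumes "F \<noteq> bot" "S \<in> balls_in av F" "T \<in> balls_in av F"
  shows "S \<subseteq> T \<or> T \<subseteq> S"
proof (rule dist_convex_nested)
  show "dist_convex S" "dist_convex T"
    using assms by (auto simp: balls_in_def is_ball_imp_dist_convex)
  have "Pt ` S \<inter> Pt ` T \<noteq> {}"
    using assms by (intro filter_sets_meet) (auto simp: balls_in_def)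
  then show "S \<inter> T \<noteq> {}" by auto
qed

text \<open>The radius is the infimum of the radii of the discs around \<open>a\<close> that belong to \<open>F\<close>; it is positive
  since \<open>F\<close> does not converge to \<open>a\<close>. The larger discs around \<open>a\<close> belong to \<open>F\<close> by construction. By
  the dichotomy, the complement of a smaller disc belongs to \<open>F\<close>, unless some open disc of radius less
  than \<open>\<rho>\<close> belongs to \<open>F\<close>; the latter would contain \<open>a\<close> and contradict the choice of \<open>\<rho>\<close>. So \<open>F\<close> contains the
  filter of the disc, and minimality gives equality.\<close>

lemma minimal_cauchy_eq_disc_filter:
  assumes F: "minimal_cauchy av F" and nc: "\<not> proj_convergent av F"
    and a: "a \<in> \<Inter>(balls_in av F)"
  obtains \<rho> where "0 < \<rho>" "F = disc_filter a \<rho>"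
proof -
  have cF: "cauchy av F" using F by (simp add: minimal_cauchy_def)
  define R where "R = {r. 0 < r \<and> Pt ` odisc a r \<in> filter_sets F}"
  define \<rho> where "\<rho> = Inf R"
  have up: "s \<in> R" if "r \<in> R" "r \<le> s" for r s
  proof -
    have "Pt ` odisc a r \<subseteq> Pt ` odisc a s" using that(2) by auto
    then show ?thesis using that filter_sets_upward by (auto simp: R_def)
  qed
  have "R \<noteq> {}"
  proof -
    obtain S where S: "is_ball av S" "Pt ` S \<in> filter_sets F"
      using balls_in_nonempty[OF cF nc] by (auto simp: balls_in_def)
    obtain r where r: "0 < r" "S \<subseteq> odisc a r" using is_ball_bounded[OF S(1)] by blast
    then have "Pt ` S \<subseteq> Pt ` odisc a r" by blast
    with S(2) r(1) have "r \<in> R" using filter_sets_upward by (auto simp: R_def)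
    then show ?thesis by blast
  qed
  have bdd: "bdd_below R" by (rule bdd_belowI[of _ 0]) (auto simp: R_def)
  have above: "s \<in> R" if s: "\<rho> < s" for s
  proof -
    obtain r where "r \<in> R" "r < s"
      using cInf_lessD[OF \<open>R \<noteq> {}\<close>] s unfolding \<rho>_def by blast
    then show ?thesis using up[of r s] by simp
  qed
  have below: "\<rho> \<le> r" if "r \<in> R" for r
    unfolding \<rho>_def using that bdd by (rule cInf_lower)
  have \<rho>: "0 < \<rho>"
  proof (rule ccontr)
    assume "\<not> 0 < \<rho>"
    then have "r \<in> R" if "0 < r" for r using above[of r] that by simp
    then show False using nc unfolding proj_convergent_iff R_def by blast
  qed
  have "filter_sets (disc_filter a \<rho>) \<subseteq> filter_sets F"
  proof (rule filter_sets_disc_filter_subsetI[OF \<rho>])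
    show "Pt ` odisc a r' \<in> filter_sets F" if "\<rho> < r'" for r'
      using above[OF that] by (simp add: R_def)
    fix b r assume r: "0 < r" "r < \<rho>"
    obtain s where s: "r < s" "s < \<rho>" "s \<in> value_group av" using value_group_dense_set[OF r] .
    have "Pt ` odisc b s \<notin> filter_sets F"
    proof
      assume in_F: "Pt ` odisc b s \<in> filter_sets F"
      have "is_ball av (odisc b s)" using s(3) unfolding is_ball_def open_ball_def by blast
      with in_F have "odisc b s \<in> balls_in av F" by (simp add: balls_in_def)
      with a have "a \<in> odisc b s" by blast
      then have "odisc b s = odisc a s" by (rule odisc_recenter)
      with in_F have "s \<in> R" using r s by (simp add: R_def)
      then show False using below s(2) by fastforce
    qed
    then show "- Pt ` cdisc b r \<in> filter_sets F" using cauchy_dichotomy[OF cF r(1) s(1), of b] by blast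
  qed
  then have "F = disc_filter a \<rho>" using minimal_cauchy_eqI[OF F cauchy_disc_filter[OF \<rho>]] by blast
  with \<rho> that show thesis by blast
qed

lemma closed_ball_iff: "closed_ball av (cdisc a \<rho>) \<longleftrightarrow> \<rho> \<in> value_group av" if "0 < \<rho>"
proof
  assume "closed_ball av (cdisc a \<rho>)"
  then obtain b s where s: "s \<in> value_group av" "cdisc a \<rho> = cdisc b s"
    unfolding closed_ball_def by blast
  then have "0 < s" by (simp add: value_group_iff)
  then have "\<rho> = s" using diam_cdisc[OF that, of a] diam_cdisc[of s b] s(2) by simp
  with s(1) show "\<rho> \<in> value_group av" by simp
qed (auto simp: closed_ball_def)

lemma irrational_ball_iff: "irrational_ball av (cdisc a \<rho>) \<longleftrightarrow> \<rho> \<notin> value_group av" if "0 < \<rho>"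
proof
  assume "irrational_ball av (cdisc a \<rho>)"
  then obtain b s where s: "0 < s" "s \<notin> value_group av" "cdisc a \<rho> = cdisc b s"
    unfolding irrational_ball_def by blast
  then have "\<rho> = s" using diam_cdisc[OF that, of a] diam_cdisc[OF s(1), of b] by simp
  with s(2) show "\<rho> \<notin> value_group av" by simp
qed (use that in \<open>auto simp: irrational_ball_def\<close>)

lemma minimal_cauchy_classification:
  assumes F: "minimal_cauchy av F" and nc: "\<not> proj_convergent av F"
    and BF: "BF = \<Inter>(balls_in av F)"
  shows "closed_ball av BF \<and> filter_base (affinoid_collection av BF) F \<and> \<not> irrational_ball av BF \<or>
    irrational_ball av BF \<and> filter_base (annulus_collection av BF) F \<and> \<not> closed_ball av BF \<or>
    BF = {}"
proof (cases "BF = {}")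
  case False
  then obtain a where a: "a \<in> \<Inter>(balls_in av F)" using BF by blast
  obtain \<rho> where \<rho>: "0 < \<rho>" and Feq: "F = disc_filter a \<rho>"
    using minimal_cauchy_eq_disc_filter[OF F nc a] .
  have B: "BF = cdisc a \<rho>" unfolding BF Feq by (rule Inter_balls_in_disc_filter[OF \<rho>])
  show ?thesis
    unfolding B closed_ball_iff[OF \<rho>] irrational_ball_iff[OF \<rho>] unfolding Feq
    using filter_base_affinoid_collection[OF \<rho>, of a] filter_base_annulus_collection[OF \<rho>, of a]
    by blast
qed simp

text \<open>A Cauchy filter contained in a minimal one equals it, and the filter generated by the sequence is
  such a filter.\<close>

lemma minimal_cauchy_filter_base_sequence:
  assumes F: "minimal_cauchy av F" and S: "range S \<subseteq> balls_in av F" "decseq S" "(\<Inter>n. S n) = {}"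
  shows "filter_base (range (\<lambda>n. Pt ` S n)) F"
proof -
  have ball: "is_ball av (S n)" and mem: "Pt ` S n \<in> filter_sets F" for n
    using S(1) by (auto simp: balls_in_def)
  have "filter_sets (sequence_filter S) \<subseteq> filter_sets F"
    using filter_base_imp_filter_sets_subset[OF filter_base_sequence_filter[OF S(2)]] mem by blast
  then have "F = sequence_filter S"
    using minimal_cauchy_eqI[OF F cauchy_sequence_filter[OF ball S(2,3)]] by blast
  then show ?thesis using filter_base_sequence_filter[OF S(2)] by simp
qed

end

theorem proposition4p2:
  fixes av :: "'k::field \<Rightarrow> real"
  assumes "ultrametric_field av"
  shows "(\<forall>F. minimal_cauchy av F \<and> \<not> proj_convergent av F \<longrightarrow>
            (let D = balls_in av F; BF = \<Inter>D in
               D \<noteq> {} \<and> (\<forall>A\<in>D. \<forall>B\<in>D. A \<subseteq> B \<or> B \<subseteq> A) \<and>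
               (closed_ball av BF \<or> irrational_ball av BF \<or> BF = {}) \<and>
               (closed_ball av BF \<longrightarrow> filter_base (affinoid_collection av BF) F) \<and>
               (irrational_ball av BF \<longrightarrow> filter_base (annulus_collection av BF) F) \<and>
               (BF = {} \<longrightarrow>
                  (\<forall>S :: nat \<Rightarrow> 'k set. range S \<subseteq> D \<and> decseq S \<and> (\<Inter>n. S n) = {} \<longrightarrow>
                     filter_base (range (\<lambda>n. Pt ` S n)) F))))
       \<and> (\<forall>B. closed_ball av B \<longrightarrow>
            (\<exists>F. minimal_cauchy av F \<and> \<not> proj_convergent av F \<and>
                 filter_base (affinoid_collection av B) F))
       \<and> (\<forall>B. irrational_ball av B \<longrightarrow>
            (\<exists>F. minimal_cauchy av F \<and> \<not> proj_convergent av F \<and>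
                 filter_base (annulus_collection av B) F))
       \<and> (\<forall>S :: nat \<Rightarrow> 'k set. (\<forall>n. is_ball av (S n)) \<and> decseq S \<and> (\<Inter>n. S n) = {} \<longrightarrow>
            (\<exists>F. minimal_cauchy av F \<and> \<not> proj_convergent av F \<and>
                 filter_base (range (\<lambda>n. Pt ` S n)) F))"
proof -
  interpret ultrametric_field av by fact
  show ?thesis
  proof (intro conjI allI impI)
    fix F assume F: "minimal_cauchy av F \<and> \<not> proj_convergent av F"
    let ?BF = "\<Inter>(balls_in av F)"
    have cF: "cauchy av F" using F by (simp add: minimal_cauchy_def)
    have ne: "balls_in av F \<noteq> {}" using balls_in_nonempty[OF cF] F by blast
    have nested: "\<forall>A\<in>balls_in av F. \<forall>B\<in>balls_in av F. A \<subseteq> B \<or> B \<subseteq> A"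
      using balls_in_nested[OF cauchyD_neq_bot[OF cF]] by blast
    have "?BF \<noteq> {}" if "closed_ball av ?BF \<or> irrational_ball av ?BF"
      using that is_ball_nonempty[of ?BF] by (auto simp: is_ball_def)
    with minimal_cauchy_classification[of F ?BF] F
    have cases: "closed_ball av ?BF \<or> irrational_ball av ?BF \<or> ?BF = {}"
      "closed_ball av ?BF \<longrightarrow> filter_base (affinoid_collection av ?BF) F"
      "irrational_ball av ?BF \<longrightarrow> filter_base (annulus_collection av ?BF) F"
      by blast+
    have sequences: "\<forall>S :: nat \<Rightarrow> 'k set. range S \<subseteq> balls_in av F \<and> decseq S \<and> (\<Inter>n. S n) = {} \<longrightarrow>
        filter_base (range (\<lambda>n. Pt ` S n)) F"
      using minimal_cauchy_filter_base_sequence F by blast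
    show "let D = balls_in av F; BF = \<Inter>D in
               D \<noteq> {} \<and> (\<forall>A\<in>D. \<forall>B\<in>D. A \<subseteq> B \<or> B \<subseteq> A) \<and>
               (closed_ball av BF \<or> irrational_ball av BF \<or> BF = {}) \<and>
               (closed_ball av BF \<longrightarrow> filter_base (affinoid_collection av BF) F) \<and>
               (irrational_ball av BF \<longrightarrow> filter_base (annulus_collection av BF) F) \<and>
               (BF = {} \<longrightarrow>
                  (\<forall>S :: nat \<Rightarrow> 'k set. range S \<subseteq> D \<and> decseq S \<and> (\<Inter>n. S n) = {} \<longrightarrow>
                     filter_base (range (\<lambda>n. Pt ` S n)) F))"
      unfolding Let_def using ne nested cases sequences by blast
  next
    fix B assume "closed_ball av B"
    then obtain a \<rho> where "\<rho> \<in> value_group av" and B: "B = cdisc a \<rho>"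
      unfolding closed_ball_def by blast
    then have \<rho>: "0 < \<rho>" by (simp add: value_group_iff)
    show "\<exists>F. minimal_cauchy av F \<and> \<not> proj_convergent av F \<and>
        filter_base (affinoid_collection av B) F"
      unfolding B using minimal_cauchy_disc_filter[OF \<rho>] not_convergent_disc_filter[OF \<rho>]
        filter_base_affinoid_collection[OF \<rho>] by blast
  next
    fix B assume "irrational_ball av B"
    then obtain a \<rho> where \<rho>: "0 < \<rho>" "\<rho> \<notin> value_group av" and B: "B = cdisc a \<rho>"
      unfolding irrational_ball_def by blast
    show "\<exists>F. minimal_cauchy av F \<and> \<not> proj_convergent av F \<and>
        filter_base (annulus_collection av B) F"
      unfolding B using minimal_cauchy_disc_filter[OF \<rho>(1)] not_convergent_disc_filter[OF \<rho>(1)]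
        filter_base_annulus_collection[OF \<rho>] by blast
  next
    fix S :: "nat \<Rightarrow> 'k set" assume "(\<forall>n. is_ball av (S n)) \<and> decseq S \<and> (\<Inter>n. S n) = {}"
    then have S: "\<And>n. is_ball av (S n)" "decseq S" "(\<Inter>n. S n) = {}" by blast+
    show "\<exists>F. minimal_cauchy av F \<and> \<not> proj_convergent av F \<and>
        filter_base (range (\<lambda>n. Pt ` S n)) F"
      using minimal_cauchy_sequence_filter[OF S] not_convergent_sequence_filter[OF S]
        filter_base_sequence_filter[OF S(2)] by blast
  qed
qed

end
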